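(* Let $N\ge3$, $p=\frac{N+2}{N-2}$ and $\lambda=\frac{N(N-2)}{4}$. Let $u\in C^2(\mathbb{H}^N\setminus\{Q\})$ be a positive radial solution of $$\Delta_{\mathbb{H}^N}u+\lambda u+u^p=0\qquad\text{in }\mathbb{H}^N\setminus\{Q\}$$ with a nonremovable singularity at $Q$. Then either $u=U_s$, where $$U_s(r)=\left(\frac{N-2}{2\sinh r}\right)^{\frac{N-2}{2}},$$ or there exist $b\in(0,v_0)$ and $T\in[0,T_b)$ such that $$u(r)=(\sinh r)^{-\frac{N-2}{2}}\,v_b\!\left(\ln\tanh\frac r2+T\right),\qquad r>0.$$
   Context: $\mathbb{H}^N$ is the $N$-dimensional hyperbolic space (constant curvature $-1$), $\Delta_{\mathbb{H}^N}$ its Laplace–Beltrami operator, $Q\in\mathbb{H}^N$ a fixed point, and $r=d_{\mathbb{H}^N}(x,Q)$. "Radial" means depending only on $r$; for radial $u=u(r)$ the equation reads $u''+(N-1)\coth r\,u'+\lambda u+u^p=0$ for $r>0$. The singularity at $Q$ is nonremovable if $u$ does not extend to a $C^2$ solution of the equation on all of $\mathbb{H}^N$. Set $v_0=\left(\frac{N-2}{2}\right)^{(N-2)/2}$. For $b\in(0,v_0)$, $v_b$ denotes the positive nonconstant periodic solution on $\mathbb{R}$ of $$v''-\frac{(N-2)^2}{4}v+v^{\frac{N+2}{N-2}}=0,$$ normalized by $v_b(0)=\inf_{\mathbb{R}}v_b=b$ (equivalently, the solution with $v_b(0)=b$, $v_b'(0)=0$), and $T_b>0$ denotes its least positive period.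 *)

theory Defs
  imports "HOL-Analysis.Analysis"
begin

section \<open>Calculus on open subsets of Euclidean space\<close>

definition C2_on :: "('a::euclidean_space) set \<Rightarrow> ('a \<Rightarrow> real) \<Rightarrow> bool" where
  "C2_on S f \<longleftrightarrow>
     (\<exists>(f' :: 'a \<Rightarrow> 'a \<Rightarrow>\<^sub>L real) (f'' :: 'a \<Rightarrow> 'a \<Rightarrow>\<^sub>L 'a \<Rightarrow>\<^sub>L real).
        (\<forall>x\<in>S. (f has_derivative blinfun_apply (f' x)) (at x)) \<and>
        (\<forall>x\<in>S. (f' has_derivative blinfun_apply (f'' x)) (at x)) \<and>
        continuous_on S f'')"

definition partial_deriv :: "'n::finite \<Rightarrow> (real^'n \<Rightarrow> real) \<Rightarrow> real^'n \<Rightarrow> real" where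
  "partial_deriv i f x = frechet_derivative f (at x) (axis i 1)"

text \<open>
  The Laplace--Beltrami operator, in a global chart, of the Riemannian metric whose matrix
  at \<open>x\<close> is \<open>g x\<close>.
\<close>

definition laplace_beltrami ::
    "(real^'n \<Rightarrow> real^'n^'n::finite) \<Rightarrow> (real^'n \<Rightarrow> real) \<Rightarrow> real^'n \<Rightarrow> real" where
  "laplace_beltrami g u x =
     1 / sqrt (det (g x)) *
     (\<Sum>i\<in>UNIV. partial_deriv i
        (\<lambda>y. sqrt (det (g y)) * (\<Sum>j\<in>UNIV. matrix_inv (g y) $ i $ j * partial_deriv j u y)) x)"

section \<open>Hyperbolic space\<close>

text \<open>
  The Poincare ball model of the hyperbolic space of constant curvature \<open>-1\<close> and dimension
  \<open>CARD('n)\<close>: the open unit ball with the metric \<open>4 |dx|\<^sup>2 / (1 - |x|\<^sup>2)\<^sup>2\<close> and its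
  distance function.
\<close>

definition hyp_space :: "(real^'n::finite) set" where
  "hyp_space = ball 0 1"

definition hyp_metric :: "real^'n \<Rightarrow> real^'n^'n::finite" where
  "hyp_metric x = mat ((2 / (1 - (norm x)\<^sup>2))\<^sup>2)"

definition hyp_dist :: "real^'n::finite \<Rightarrow> real^'n \<Rightarrow> real" where
  "hyp_dist x y =
     arcosh (1 + 2 * (norm (x - y))\<^sup>2 / ((1 - (norm x)\<^sup>2) * (1 - (norm y)\<^sup>2)))"

definition hyp_laplacian :: "(real^'n::finite \<Rightarrow> real) \<Rightarrow> real^'n \<Rightarrow> real" where
  "hyp_laplacian = laplace_beltrami hyp_metric"

section \<open>The equation\<close>

text \<open>
  The power \<open>u\<^sup>p\<close> is rendered by \<open>powr\<close>, which has its usual meaning for nonnegative \<open>u\<close>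
  and \<open>p > 0\<close>.  An extension of a positive solution across a point is nonnegative by
  continuity, so no other values occur.
\<close>

definition hyp_solution_on ::
    "real \<Rightarrow> real \<Rightarrow> (real^'n::finite) set \<Rightarrow> (real^'n \<Rightarrow> real) \<Rightarrow> bool" where
  "hyp_solution_on lam p S u \<longleftrightarrow>
     C2_on S u \<and> (\<forall>x\<in>S. hyp_laplacian u x + lam * u x + u x powr p = 0)"

text \<open>
  A function on the punctured space \<open>hyp_space - {Q}\<close> is a function on the whole type of which
  only the values on \<open>hyp_space - {Q}\<close> matter.
\<close>

definition radial_about :: "real^'n::finite \<Rightarrow> (real^'n \<Rightarrow> real) \<Rightarrow> bool" where
  "radial_about Q u \<longleftrightarrow>
     (\<forall>x\<in>hyp_space - {Q}. \<forall>y\<in>hyp_space - {Q}. hyp_dist x Q = hyp_dist y Q \<longrightarrow> u x = u y)"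

definition removable_singularity ::
    "real \<Rightarrow> real \<Rightarrow> real^'n::finite \<Rightarrow> (real^'n \<Rightarrow> real) \<Rightarrow> bool" where
  "removable_singularity lam p Q u \<longleftrightarrow>
     (\<exists>w. hyp_solution_on lam p hyp_space w \<and> (\<forall>x\<in>hyp_space - {Q}. w x = u x))"

section \<open>The singular solution and the periodic profiles\<close>

definition U_s :: "nat \<Rightarrow> real \<Rightarrow> real" where
  "U_s N r = ((real N - 2) / (2 * sinh r)) powr ((real N - 2) / 2)"

definition v_0 :: "nat \<Rightarrow> real" where
  "v_0 N = ((real N - 2) / 2) powr ((real N - 2) / 2)"

definition profile_solution :: "nat \<Rightarrow> (real \<Rightarrow> real) \<Rightarrow> bool" where
  "profile_solution N v \<longleftrightarrow>
     (\<exists>v' v''. \<forall>t. (v has_real_derivative v' t) (at t) \<and>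
                   (v' has_real_derivative v'' t) (at t) \<and>
                   v'' t - (real N - 2)\<^sup>2 / 4 * v t
                     + v t powr ((real N + 2) / (real N - 2)) = 0)"

definition is_period :: "(real \<Rightarrow> real) \<Rightarrow> real \<Rightarrow> bool" where
  "is_period v T \<longleftrightarrow> (\<forall>t. v (t + T) = v t)"

text \<open>
  For \<open>0 < b < v_0 N\<close> the description below is satisfied by exactly one function.
\<close>

definition v_per :: "nat \<Rightarrow> real \<Rightarrow> real \<Rightarrow> real" where
  "v_per N b = (THE v. profile_solution N v \<and> (\<forall>t. 0 < v t) \<and>
                       \<not> v constant_on UNIV \<and> (\<exists>T>0. is_period v T) \<and>
                       v 0 = (INF t. v t) \<and> v 0 = b)"

definition T_per :: "nat \<Rightarrow> real \<Rightarrow> real" where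
  "T_per N b = (LEAST T. 0 < T \<and> is_period (v_per N b) T)"

end

theory Submission
  imports Defs "HOL-Real_Asymp.Real_Asymp"
begin

text \<open>
  Write \<open>c = (N - 2) / 2\<close>, so that \<open>lam = c (c + 1)\<close> and \<open>p = 1 + 2 / c\<close>, and let \<open>r\<close> be the distance
  to \<open>Q\<close>.  The value of \<open>lam\<close> is the one for which the equation is conformally invariant: in the
  cylindrical variable \<open>s = ln (tanh (r / 2))\<close>, which runs through the negative half line, the
  function \<open>V(s) = (sinh r)\<^sup>c u(r)\<close> satisfies the autonomous equation \<open>V'' = c\<^sup>2 V - V\<^sup>p\<close>
  (\<open>cylinder_profile\<close>).  The theorem is therefore a statement about the phase plane of one
  conservative equation, read on a half line ending at the singularity \<open>s = - \<infinity>\<close>.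

  The function \<open>cosh r\<close> is rational in the coordinates of the ball and satisfies
  \<open>\<bar>\<nabla> cosh r\<bar>\<^sup>2 = cosh\<^sup>2 r - 1\<close> and \<open>\<Delta> cosh r = N cosh r\<close>.  These two identities give the Laplacian
  of every function of \<open>cosh r\<close> (\<open>hyp_laplacian_radial\<close>) for an arbitrary centre \<open>Q\<close>, without moving
  \<open>Q\<close> to the origin by an isometry.

  For the classification on the half line (\<open>profile_half_line_cases\<close>) the decisive question is how
  often \<open>V'\<close> vanishes.  By uniqueness for the initial value problem, a zero of \<open>V'\<close> is a centre
  of symmetry of \<open>V\<close>.  One zero hence extends \<open>V\<close> to the whole line by reflection, and a second one makes
  it periodic, a composition of two reflections being a translation; this is where the profiles
  \<open>v_per\<close>, or the equilibrium \<open>V = c\<^sup>c\<close>, that is \<open>U_s\<close>, arise.  With at most one zero, \<open>V\<close> is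
  monotone near \<open>- \<infinity>\<close> and converges there to a zero \<open>L\<close> of the force.  If \<open>L\<close> were the positive
  zero, the energy would be at its minimum and \<open>V'\<close> would vanish, so \<open>L = 0\<close> and the energy is zero
  (\<open>profile_monotone_energy_zero\<close>).  On the zero energy level \<open>V\<^sup>-\<^sup>1\<^sup>/\<^sup>c\<close> solves the linear equation
  \<open>z'' = z\<close> (\<open>profile_energy_zero\<close>), and going back to the ball turns \<open>u\<close> into a negative power of an
  affine function of \<open>cosh r\<close> that is positive at \<open>Q\<close> too.  Such a \<open>u\<close> extends smoothly across
  \<open>Q\<close> (\<open>homoclinic_hyp_solution\<close>), which a nonremovable singularity excludes.
\<close>

section \<open>The profile equation and its uniqueness theorem\<close>

text \<open>
  The derivative is carried as a second function because a solution is treated as a curve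
  \<open>(v, v')\<close> in the phase plane, to be compared with others through its initial data.
\<close>

definition profile_on :: "real \<Rightarrow> real set \<Rightarrow> (real \<Rightarrow> real) \<Rightarrow> (real \<Rightarrow> real) \<Rightarrow> bool" where
  "profile_on c I v v' \<longleftrightarrow>
     (\<forall>t\<in>I. 0 < v t \<and> (v has_real_derivative v' t) (at t) \<and>
            (v' has_real_derivative (c\<^sup>2 * v t - v t powr (1 + 2 / c))) (at t))"

lemma profile_onD:
  assumes "profile_on c I v v'" "t \<in> I"
  shows "0 < v t" "(v has_real_derivative v' t) (at t)"
    "(v' has_real_derivative (c\<^sup>2 * v t - v t powr (1 + 2 / c))) (at t)"
  using assms by (auto simp: profile_on_def)

lemma profile_on_subset: "profile_on c I v v' \<Longrightarrow> J \<subseteq> I \<Longrightarrow> profile_on c J v v'"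
  by (auto simp: profile_on_def)

lemma profile_on_reflect:
  assumes "profile_on c I v v'"
  shows "profile_on c {t. m - t \<in> I} (\<lambda>t. v (m - t)) (\<lambda>t. - v' (m - t))"
  unfolding profile_on_def
proof (intro ballI conjI)
  fix t assume "t \<in> {t. m - t \<in> I}"
  then have t: "m - t \<in> I" by simp
  note D = profile_onD[OF assms t]
  show "0 < v (m - t)" by (rule D)
  have lin: "((\<lambda>t. m - t) has_real_derivative - 1) (at t)"
    by (auto intro!: derivative_eq_intros)
  show "((\<lambda>t. v (m - t)) has_real_derivative - v' (m - t)) (at t)"
    using DERIV_chain2[where f = v and g = "\<lambda>t. m - t", OF D(2) lin] by simp
  show "((\<lambda>t. - v' (m - t)) has_real_derivative
      c\<^sup>2 * v (m - t) - v (m - t) powr (1 + 2 / c)) (at t)"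
    using DERIV_minus[OF DERIV_chain2[where f = v' and g = "\<lambda>t. m - t", OF D(3) lin]] by simp
qed

lemma profile_on_shift:
  assumes "profile_on c I v v'"
  shows "profile_on c {t. t + m \<in> I} (\<lambda>t. v (t + m)) (\<lambda>t. v' (t + m))"
  unfolding profile_on_def
proof (intro ballI conjI)
  fix t assume "t \<in> {t. t + m \<in> I}"
  then have t: "t + m \<in> I" by simp
  note D = profile_onD[OF assms t]
  show "0 < v (t + m)" by (rule D)
  show "((\<lambda>t. v (t + m)) has_real_derivative v' (t + m)) (at t)"
    using D(2) by (simp add: DERIV_shift)
  show "((\<lambda>t. v' (t + m)) has_real_derivative c\<^sup>2 * v (t + m) - v (t + m) powr (1 + 2 / c)) (at t)"
    using D(3) by (simp add: DERIV_shift)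
qed

lemma powr_lipschitz:
  fixes x y M p :: real
  assumes "1 \<le> p" "0 < x" "x \<le> M" "0 < y" "y \<le> M"
  shows "\<bar>x powr p - y powr p\<bar> \<le> p * M powr (p - 1) * \<bar>x - y\<bar>"
proof -
  have *: "\<bar>b powr p - a powr p\<bar> \<le> p * M powr (p - 1) * \<bar>b - a\<bar>"
    if "0 < a" "a < b" "b \<le> M" for a b :: real
  proof -
    have "\<exists>z>a. z < b \<and> b powr p - a powr p = (b - a) * (p * z powr (p - 1))"
      by (rule MVT2[OF \<open>a < b\<close>]) (use that in \<open>auto intro!: derivative_eq_intros\<close>)
    then obtain z where z: "a < z" "z < b" "b powr p - a powr p = (b - a) * (p * z powr (p - 1))"
      by blast
    have "z powr (p - 1) \<le> M powr (p - 1)"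
      using z that assms(1) by (intro powr_mono2) auto
    then have "(b - a) * (p * z powr (p - 1)) \<le> (b - a) * (p * M powr (p - 1))"
      using that assms(1) by (intro mult_left_mono) auto
    moreover have "0 \<le> (b - a) * (p * z powr (p - 1))"
      using that assms(1) by simp
    ultimately show ?thesis using z(3) that by (simp add: mult_ac)
  qed
  show ?thesis
    using *[of x y] *[of y x] assms by (cases x y rule: linorder_cases) (auto simp: abs_minus_commute)
qed

text \<open>
  On a compact interval both solutions stay in a bounded range of positive values, where the force
  is Lipschitz.  The squared phase plane distance \<open>q\<close> of the two solutions then satisfies
  \<open>q' \<le> (1 + K) q\<close>, and Gronwall's argument keeps it at zero.
\<close>

lemma profile_unique_forward:
  assumes c: "0 < c" and ab: "a \<le> b"
    and v: "profile_on c {a..b} v v'" and w: "profile_on c {a..b} w w'"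
    and eq: "v a = w a" "v' a = w' a"
  shows "v b = w b \<and> v' b = w' b"
proof -
  let ?p = "1 + 2 / c"
  have "continuous_on {a..b} v" "continuous_on {a..b} w"
    using profile_onD(2)[OF v] profile_onD(2)[OF w]
    by (meson DERIV_isCont continuous_at_imp_continuous_on)+
  then have "compact (v ` {a..b})" "compact (w ` {a..b})"
    by (auto intro!: compact_continuous_image)
  then have "bounded (v ` {a..b} \<union> w ` {a..b})"
    using compact_imp_bounded by blast
  then obtain M where M: "\<And>t. t \<in> {a..b} \<Longrightarrow> v t \<le> M" "\<And>t. t \<in> {a..b} \<Longrightarrow> w t \<le> M"
    unfolding bounded_iff by (fastforce simp: abs_le_iff)
  define K where "K = c\<^sup>2 + ?p * M powr (?p - 1)"
  have K0: "0 \<le> K" unfolding K_def using c by simp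
  define q where "q = (\<lambda>t. (v t - w t)\<^sup>2 + (v' t - w' t)\<^sup>2)"
  \<comment> \<open>The integrating factor turns the differential inequality for \<open>q\<close> into monotonicity.\<close>
  define f where "f = (\<lambda>t. q t * exp (- (1 + K) * t))"
  have "f b \<le> f a"
  proof (rule DERIV_nonpos_imp_nonincreasing[OF ab])
    fix t assume "a \<le> t" "t \<le> b"
    then have t: "t \<in> {a..b}" by simp
    note V = profile_onD[OF v t] and W = profile_onD[OF w t]
    define x y where "x = v t - w t" and "y = v' t - w' t"
    define d where "d = (c\<^sup>2 * v t - v t powr ?p) - (c\<^sup>2 * w t - w t powr ?p)"
    have lip: "\<bar>v t powr ?p - w t powr ?p\<bar> \<le> ?p * M powr (?p - 1) * \<bar>x\<bar>"
      unfolding x_def using c V(1) W(1) M[OF t] by (intro powr_lipschitz) auto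
    have "\<bar>d\<bar> \<le> c\<^sup>2 * \<bar>x\<bar> + ?p * M powr (?p - 1) * \<bar>x\<bar>"
    proof -
      have "d = c\<^sup>2 * x - (v t powr ?p - w t powr ?p)"
        by (simp add: d_def x_def algebra_simps)
      then have "\<bar>d\<bar> \<le> \<bar>c\<^sup>2 * x\<bar> + \<bar>v t powr ?p - w t powr ?p\<bar>"
        using abs_triangle_ineq4 by metis
      then show ?thesis using lip by (simp add: abs_mult)
    qed
    then have d: "\<bar>d\<bar> \<le> K * \<bar>x\<bar>" unfolding K_def by (simp add: algebra_simps)
    have "2 * y * d \<le> 2 * \<bar>y\<bar> * (K * \<bar>x\<bar>)"
    proof -
      have "2 * y * d \<le> \<bar>2 * y * d\<bar>" by (rule abs_ge_self)
      also have "\<dots> = 2 * \<bar>y\<bar> * \<bar>d\<bar>" by (simp add: abs_mult)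
      also have "\<dots> \<le> 2 * \<bar>y\<bar> * (K * \<bar>x\<bar>)" using d by (intro mult_left_mono) auto
      finally show ?thesis .
    qed
    also have "\<dots> = K * (2 * \<bar>x\<bar> * \<bar>y\<bar>)" by simp
    also have "\<dots> \<le> K * (\<bar>x\<bar>\<^sup>2 + \<bar>y\<bar>\<^sup>2)" using K0 by (intro mult_left_mono sum_squares_bound)
    finally have yd: "2 * y * d \<le> K * (x\<^sup>2 + y\<^sup>2)" by simp
    have xy: "2 * x * y \<le> x\<^sup>2 + y\<^sup>2" by (rule sum_squares_bound)
    have q': "(q has_real_derivative 2 * x * y + 2 * y * d) (at t)"
      unfolding q_def
      by (rule derivative_eq_intros V W refl | simp)+ (simp add: algebra_simps x_def y_def d_def)
    have "(f has_real_derivative (2 * x * y + 2 * y * d - (1 + K) * (x\<^sup>2 + y\<^sup>2)) * exp (- (1 + K) * t)) (at t)"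
      unfolding f_def
      by (rule derivative_eq_intros q' refl | simp)+ (simp add: q_def x_def y_def algebra_simps)
    moreover have "2 * x * y + 2 * y * d - (1 + K) * (x\<^sup>2 + y\<^sup>2) \<le> 0"
      using yd xy by (simp add: algebra_simps)
    ultimately show "\<exists>y. (f has_real_derivative y) (at t) \<and> y \<le> 0"
      by (meson exp_ge_zero mult_nonpos_nonneg)
  qed
  also have "f a = 0" by (simp add: f_def q_def eq)
  finally have "q b \<le> 0" by (simp add: f_def mult_le_0_iff)
  then show ?thesis unfolding q_def sum_power2_le_zero_iff by simp
qed

text \<open>
  Backwards in time the result follows by reflecting both solutions.
\<close>

lemma profile_unique:
  assumes c: "0 < c" and I: "is_interval I" and t0: "t0 \<in> I"
    and v: "profile_on c I v v'" and w: "profile_on c I w w'"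
    and eq: "v t0 = w t0" "v' t0 = w' t0" and t: "t \<in> I"
  shows "v t = w t" "v' t = w' t"
proof -
  have "v t = w t \<and> v' t = w' t"
  proof (cases "t0 \<le> t")
    case True
    have "{t0..t} \<subseteq> I" using mem_is_interval_1_I[OF I t0 t] by auto
    then show ?thesis
      using profile_unique_forward[OF c True, of v v' w w'] v w eq profile_on_subset by blast
  next
    case False
    have sub: "{0..t0 - t} \<subseteq> {s. t0 - s \<in> I}" 
      using mem_is_interval_1_I[OF I t t0] by auto
    have "v (t0 - (t0 - t)) = w (t0 - (t0 - t)) \<and> - v' (t0 - (t0 - t)) = - w' (t0 - (t0 - t))"
      using profile_unique_forward[OF c, of 0 "t0 - t",
          OF _ profile_on_subset[OF profile_on_reflect[OF v] sub]
               profile_on_subset[OF profile_on_reflect[OF w] sub]] eq False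
      by simp
    then show ?thesis by simp
  qed
  then show "v t = w t" "v' t = w' t" by auto
qed

section \<open>Reflection in critical points, and the energy\<close>

text \<open>
  Where \<open>v'\<close> vanishes, \<open>v\<close> and its reflection have the same initial data and so agree wherever both
  are defined; the reflection supplies the values to the right of \<open>B\<close>.  The two pieces overlap in an
  open interval, so no one-sided derivatives have to be matched.
\<close>

lemma profile_critical_extension:
  assumes c: "0 < c" and v: "profile_on c {..<B} v v'" and s: "s < B" "v' s = 0"
  obtains W W' where "profile_on c UNIV W W'" "\<And>t. t < B \<Longrightarrow> W t = v t \<and> W' t = v' t"
proof -
  define r r' where "r = (\<lambda>t. v (2 * s - t))" and "r' = (\<lambda>t. - v' (2 * s - t))"
  have r: "profile_on c {2 * s - B<..} r r'"
    unfolding r_def r'_def by (rule profile_on_subset[OF profile_on_reflect[OF v]]) auto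
  have sym: "v t = r t" "v' t = r' t" if "2 * s - B < t" "t < B" for t
  proof -
    have J: "is_interval {2 * s - B<..<B}" by (simp add: is_interval_oo)
    have vJ: "profile_on c {2 * s - B<..<B} v v'" and rJ: "profile_on c {2 * s - B<..<B} r r'"
      using v r by (auto intro: profile_on_subset)
    show "v t = r t" "v' t = r' t"
      using profile_unique[OF c J, of s v v' r r' t] vJ rJ s that
      by (auto simp: r_def r'_def)
  qed
  \<comment> \<open>On the overlap \<open>v\<close> and \<open>r\<close> agree, so \<open>W\<close> is locally one of the two solutions.\<close>
  define W W' where "W = (\<lambda>t. if t < B then v t else r t)"
    and "W' = (\<lambda>t. if t < B then v' t else r' t)"
  have Wv: "W t = v t" "W' t = v' t" if "t < B" for t
    using that by (auto simp: W_def W'_def)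
  have Wr: "W t = r t" "W' t = r' t" if "2 * s - B < t" for t
    using sym[OF that] by (auto simp: W_def W'_def)
  have "profile_on c UNIV W W'"
    unfolding profile_on_def
  proof (intro ballI conjI)
    fix t :: real
    have "t < B \<or> 2 * s - B < t" using s by auto
    then obtain S f f' where S: "open S" "t \<in> S" "profile_on c S f f'"
      "\<And>x. x \<in> S \<Longrightarrow> W x = f x" "\<And>x. x \<in> S \<Longrightarrow> W' x = f' x"
    proof
      assume "t < B"
      then show ?thesis using that[of "{..<B}" v v'] v Wv by auto
    next
      assume "2 * s - B < t"
      then show ?thesis using that[of "{2 * s - B<..}" r r'] r Wr by auto
    qed
    note D = profile_onD[OF S(3,2)]
    show "0 < W t" using D S by simp
    show "(W has_real_derivative W' t) (at t)"
      using has_field_derivative_transform_within_open[OF D(2) S(1,2)] S(2,4,5) by simp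
    show "(W' has_real_derivative c\<^sup>2 * W t - W t powr (1 + 2 / c)) (at t)"
      using has_field_derivative_transform_within_open[OF D(3) S(1,2)] S(2,4,5) by simp
  qed
  with Wv show ?thesis using that by blast
qed

lemma profile_symmetric:
  assumes c: "0 < c" and W: "profile_on c UNIV W W'" and s: "W' s = 0"
  shows "W (2 * s - t) = W t"
proof -
  have r: "profile_on c UNIV (\<lambda>t. W (2 * s - t)) (\<lambda>t. - W' (2 * s - t))"
    by (rule profile_on_subset[OF profile_on_reflect[OF W]]) auto
  show ?thesis
    using profile_unique(1)[OF c is_interval_univ UNIV_I W r, of s t] s by simp
qed

lemma profile_periodic:
  assumes c: "0 < c" and W: "profile_on c UNIV W W'" and s: "W' s = 0" "W' s' = 0"
  shows "is_period W (2 * (s' - s))"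
  unfolding is_period_def
proof
  fix t
  have "W (2 * s' - (2 * s - t)) = W (2 * s - t)" by (rule profile_symmetric[OF c W s(2)])
  also have "\<dots> = W t" by (rule profile_symmetric[OF c W s(1)])
  finally show "W (t + 2 * (s' - s)) = W t" by (simp add: algebra_simps)
qed

text \<open>
  The equation is Newton's equation of motion in this potential, so \<open>v'\<^sup>2 / 2 + potential c v\<close> is
  conserved.
\<close>

definition potential :: "real \<Rightarrow> real \<Rightarrow> real" where
  "potential c x = c / (2 * (c + 1)) * x powr (2 + 2 / c) - c\<^sup>2 * x\<^sup>2 / 2"

lemma potential_deriv:
  assumes "0 < c" "0 < x"
  shows "(potential c has_real_derivative - (c\<^sup>2 * x - x powr (1 + 2 / c))) (at x)"
proof -
  have "c / (2 * (c + 1)) * (2 + 2 / c) = 1" using assms by (simp add: divide_simps)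
  then have *: "c / (2 * (c + 1)) * ((2 + 2 / c) * x powr (1 + 2 / c)) = x powr (1 + 2 / c)"
    by (metis mult.assoc mult_1)
  have "((\<lambda>x. c / (2 * (c + 1)) * x powr (2 + 2 / c) - c\<^sup>2 * x\<^sup>2 / 2) has_real_derivative
      c / (2 * (c + 1)) * ((2 + 2 / c) * x powr (1 + 2 / c)) - c\<^sup>2 * x) (at x)"
    using assms by (auto intro!: derivative_eq_intros)
  then show ?thesis unfolding potential_def[abs_def] * by simp
qed

lemma profile_energy:
  assumes c: "0 < c" and I: "is_interval I" and v: "profile_on c I v v'"
  obtains E where "\<And>t. t \<in> I \<Longrightarrow> (v' t)\<^sup>2 / 2 + potential c (v t) = E"
proof -
  have "((\<lambda>t. (v' t)\<^sup>2 / 2 + potential c (v t)) has_real_derivative 0) (at t)" if "t \<in> I" for t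
  proof -
    note D = profile_onD[OF v that]
    note P = DERIV_chain2[OF potential_deriv[OF c D(1)] D(2)]
    show ?thesis
      by (rule derivative_eq_intros D P refl | simp)+ (simp add: algebra_simps)
  qed
  then have "\<exists>E. \<forall>t\<in>I. (v' t)\<^sup>2 / 2 + potential c (v t) = E"
    using I by (intro has_field_derivative_zero_constant)
      (auto simp: is_interval_convex intro: has_field_derivative_at_within)
  then show ?thesis using that by blast
qed

lemma powr_2_over_equilibrium: "0 < c \<Longrightarrow> (c powr c) powr (2 / c) = c\<^sup>2" for c :: real
  by (simp add: powr_powr)

lemma force_factor: "0 < x \<Longrightarrow> c\<^sup>2 * x - x powr (1 + 2 / c) = x * (c\<^sup>2 - x powr (2 / c))"
  for x c :: real
  by (simp add: powr_add algebra_simps)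

text \<open>
  The only positive zero of the force is \<open>c\<^sup>c\<close>, the number \<open>v_0 N\<close>.
\<close>

lemma force_sign:
  fixes c x :: real
  assumes "0 < c" "0 < x"
  shows "0 \<le> c\<^sup>2 * x - x powr (1 + 2 / c) \<longleftrightarrow> x \<le> c powr c"
    and "c\<^sup>2 * x - x powr (1 + 2 / c) \<le> 0 \<longleftrightarrow> c powr c \<le> x"
proof -
  have m: "a powr (2 / c) \<le> b powr (2 / c) \<longleftrightarrow> a \<le> b" if "0 < a" "0 < b" for a b
    using assms(1) that powr_less_mono2[of "2 / c" b a] powr_mono2[of "2 / c" a b]
    by (auto simp: not_less[symmetric])
  have pos: "0 < c powr c" using assms by simp
  have e: "c\<^sup>2 = (c powr c) powr (2 / c)" using powr_2_over_equilibrium assms(1) by simp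
  have "0 \<le> x * (c\<^sup>2 - x powr (2 / c)) \<longleftrightarrow> x powr (2 / c) \<le> c\<^sup>2"
    "x * (c\<^sup>2 - x powr (2 / c)) \<le> 0 \<longleftrightarrow> c\<^sup>2 \<le> x powr (2 / c)"
    using assms(2) by (simp_all add: zero_le_mult_iff mult_le_0_iff)
  then show "0 \<le> c\<^sup>2 * x - x powr (1 + 2 / c) \<longleftrightarrow> x \<le> c powr c"
    "c\<^sup>2 * x - x powr (1 + 2 / c) \<le> 0 \<longleftrightarrow> c powr c \<le> x"
    unfolding force_factor[OF assms(2)]
    using m[OF assms(2) pos] m[OF pos assms(2)] e by simp_all
qed

lemma potential_mono:
  assumes c: "0 < c" and xy: "c powr c \<le> x" "x \<le> y"
  shows "potential c x \<le> potential c y"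
proof (rule DERIV_nonneg_imp_nondecreasing[OF xy(2)])
  fix z assume z: "x \<le> z" "z \<le> y"
  have "0 < c powr c" using c by simp
  then have "0 < z" using z xy by linarith
  then show "\<exists>d. (potential c has_real_derivative d) (at z) \<and> 0 \<le> d"
    using potential_deriv[OF c, of z] force_sign(2)[OF c, of z] z xy by force
qed

lemma potential_minimum:
  assumes c: "0 < c" and x: "0 < x"
  shows "potential c (c powr c) \<le> potential c x"
proof (cases "c powr c \<le> x")
  case True
  then show ?thesis using potential_mono[OF c] by simp
next
  case False
  show ?thesis
  proof (rule DERIV_nonpos_imp_nonincreasing[of x "c powr c"])
    fix y assume y: "x \<le> y" "y \<le> c powr c"
    show "\<exists>d. (potential c has_real_derivative d) (at y) \<and> d \<le> 0"
      using potential_deriv[OF c, of y] force_sign(1)[OF c, of y] x y by force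
  qed (use False in simp)
qed

lemma potential_unbounded:
  assumes c: "0 < c"
  obtains M where "\<And>x. M < x \<Longrightarrow> E < potential c x"
proof -
  have "filterlim (\<lambda>x. x powr (2 / c)) at_top at_top"
    using c by real_asymp
  then have "\<forall>\<^sub>F x in at_top. (1 + c\<^sup>2 / 2) / (c / (2 * (c + 1))) \<le> x powr (2 / c)"
    by (auto simp: filterlim_at_top)
  moreover have "\<forall>\<^sub>F x :: real in at_top. max 1 (E + 1) \<le> x" by (rule eventually_ge_at_top)
  ultimately have "\<forall>\<^sub>F x in at_top. E < potential c x"
  proof eventually_elim
    case (elim x)
    have x: "1 \<le> x" "E < x" using elim by auto
    have "1 + c\<^sup>2 / 2 \<le> c / (2 * (c + 1)) * x powr (2 / c)"
      using elim(1) c by (simp add: field_simps)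
    then have "x\<^sup>2 * 1 \<le> x\<^sup>2 * (c / (2 * (c + 1)) * x powr (2 / c) - c\<^sup>2 / 2)"
      by (intro mult_left_mono) auto
    also have "\<dots> = potential c x"
      using x by (simp add: potential_def powr_add algebra_simps)
    finally have "x\<^sup>2 \<le> potential c x" by simp
    moreover have "x \<le> x\<^sup>2" using x by (simp add: power2_eq_square)
    ultimately show ?case using x by linarith
  qed
  then obtain M where "\<And>x. M \<le> x \<Longrightarrow> E < potential c x"
    unfolding eventually_at_top_linorder by blast
  then show ?thesis using that by (meson less_imp_le)
qed

section \<open>Monotone profiles have zero energy\<close>

text \<open>
  The increments \<open>f t - f (t - 1)\<close> tend to zero because \<open>f\<close> converges, and to \<open>l\<close> because they are
  values of \<open>f'\<close> by the mean value theorem.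
\<close>

lemma deriv_limit_at_bot_zero:
  fixes f f' :: "real \<Rightarrow> real"
  assumes D: "\<And>t. t < a \<Longrightarrow> (f has_real_derivative f' t) (at t)"
    and f: "(f \<longlongrightarrow> L) at_bot" and f': "(f' \<longlongrightarrow> l) at_bot"
  shows "l = 0"
proof -
  have "\<exists>z. t - 1 < z \<and> z < t \<and> f t - f (t - 1) = f' z" if "t < a" for t
    using MVT2[of "t - 1" t f f'] D that by force
  then obtain z where z: "\<And>t. t < a \<Longrightarrow> t - 1 < z t \<and> z t < t \<and> f t - f (t - 1) = f' (z t)"
    by metis
  have "filterlim z at_bot at_bot"
    unfolding filterlim_at_bot
  proof
    fix Z
    show "\<forall>\<^sub>F t in at_bot. z t \<le> Z"
      using eventually_gt_at_bot[of a] eventually_gt_at_bot[of Z]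
      by eventually_elim (use z in force)
  qed
  then have "((\<lambda>t. f' (z t)) \<longlongrightarrow> l) at_bot" by (rule filterlim_compose[OF f'])
  moreover have "\<forall>\<^sub>F t in at_bot. f' (z t) = f t - f (t - 1)"
    using eventually_gt_at_bot[of a] by eventually_elim (use z in force)
  ultimately have 1: "((\<lambda>t. f t - f (t - 1)) \<longlongrightarrow> l) at_bot"
    by (rule Lim_transform_eventually)
  have "filterlim (\<lambda>t :: real. t - 1) at_bot at_bot" by real_asymp
  from tendsto_diff[OF f filterlim_compose[OF f this]]
  have "((\<lambda>t. f t - f (t - 1)) \<longlongrightarrow> 0) at_bot" by simp
  with 1 show ?thesis using tendsto_unique trivial_limit_at_bot_linorder by blast
qed

lemma increasing_bounded_tendsto_at_bot:
  fixes f :: "real \<Rightarrow> real"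
  assumes mono: "\<And>s t. s \<le> t \<Longrightarrow> t < a \<Longrightarrow> f s \<le> f t" and m: "\<And>t. t < a \<Longrightarrow> m \<le> f t"
  obtains L where "(f \<longlongrightarrow> L) at_bot" "m \<le> L"
proof -
  define L where "L = (INF t\<in>{..<a}. f t)"
  have ne: "{..<a} \<noteq> {}" using lt_ex[of a] by blast
  have bdd: "bdd_below (f ` {..<a})" using m by (auto intro!: bdd_belowI)
  have "(f \<longlongrightarrow> L) at_bot"
  proof (rule decreasing_tendsto)
    show "\<forall>\<^sub>F t in at_bot. L \<le> f t"
      using eventually_gt_at_bot[of a]
      by eventually_elim (auto simp: L_def intro!: cINF_lower bdd)
  next
    fix x assume "L < x"
    then obtain t where t: "t < a" "f t < x"
      using cINF_less_iff[OF ne bdd] by (auto simp: L_def)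
    show "\<forall>\<^sub>F s in at_bot. f s < x"
      using eventually_gt_at_bot[of t]
      by eventually_elim (use t mono in \<open>meson le_less_trans less_imp_le\<close>)
  qed
  moreover have "m \<le> L" unfolding L_def by (rule cINF_greatest[OF ne]) (use m in simp)
  ultimately show ?thesis using that by blast
qed

lemma continuous_nonzero_sign:
  fixes f :: "real \<Rightarrow> real"
  assumes "continuous_on I f" "is_interval I" "\<And>t. t \<in> I \<Longrightarrow> f t \<noteq> 0"
  shows "(\<forall>t\<in>I. 0 < f t) \<or> (\<forall>t\<in>I. f t < 0)"
proof (rule ccontr)
  assume "\<not> ?thesis"
  then obtain s t where "s \<in> I" "t \<in> I" "f s \<le> 0" "0 \<le> f t" by force
  moreover have "is_interval (f ` I)"
    using assms(1,2) connected_continuous_image is_interval_connected_1 by blast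
  ultimately have "0 \<in> f ` I" using mem_is_interval_1_I by blast
  with assms(3) show False by force
qed

text \<open>
  A solution without critical points is monotone, and it is bounded because its energy bounds the
  potential; let \<open>L\<close> be its limit at \<open>- \<infinity>\<close>.  Energy conservation gives a limit for \<open>v'\<close> and the
  equation one for \<open>v''\<close>, and both limits must be zero.  So \<open>E = potential c L\<close> and \<open>L\<close> is a zero of
  the force.  The case \<open>L = c\<^sup>c\<close> is impossible: \<open>E\<close> would be the minimum of the potential,
  which forces \<open>v' = 0\<close>.  There remains \<open>L = 0\<close>.
\<close>

lemma profile_monotone_energy_zero:
  assumes c: "0 < c" and v: "profile_on c {..<a} v v'" and nz: "\<And>t. t < a \<Longrightarrow> v' t \<noteq> 0"
    and E: "\<And>t. t < a \<Longrightarrow> (v' t)\<^sup>2 / 2 + potential c (v t) = E"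
  shows "E = 0"
proof -
  have D: "0 < v t" "(v has_real_derivative v' t) (at t)"
    "(v' has_real_derivative (c\<^sup>2 * v t - v t powr (1 + 2 / c))) (at t)" if "t < a" for t
    using profile_onD[OF v] that by auto
  have "continuous_on {..<a} v'"
    using D(3) by (meson DERIV_isCont continuous_at_imp_continuous_on lessThan_iff)
  then have "(\<forall>t\<in>{..<a}. 0 < v' t) \<or> (\<forall>t\<in>{..<a}. v' t < 0)"
    using nz by (intro continuous_nonzero_sign) (auto simp: is_interval_ci)
  \<comment> \<open>A sign \<open>\<sigma>\<close> treats increasing and decreasing solutions together.\<close>
  then obtain \<sigma> :: real where sg: "\<And>t. t < a \<Longrightarrow> v' t = \<sigma> * \<bar>v' t\<bar>" "\<sigma> = 1 \<or> \<sigma> = - 1"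
    by (metis abs_of_neg abs_of_pos lessThan_iff minus_minus mult_1 mult_minus_left)
  have ev_pos: "\<forall>\<^sub>F t in at_bot. 0 \<le> v t"
    using eventually_gt_at_bot[of a] by eventually_elim (use D(1) in \<open>simp add: less_imp_le\<close>)
  have "\<exists>L\<ge>0. (v \<longlongrightarrow> L) at_bot"
  proof (cases "\<sigma> = 1")
    case True
    have "v s \<le> v t" if "s \<le> t" "t < a" for s t
      by (rule DERIV_nonneg_imp_nondecreasing[OF that(1)])
        (use D(2) sg that True in \<open>metis abs_ge_zero mult_1 order.strict_trans1\<close>)
    then show ?thesis
      using increasing_bounded_tendsto_at_bot[of a v 0] D(1) by (metis less_imp_le)
  next
    case False
    obtain M where M: "\<And>x. M < x \<Longrightarrow> E < potential c x" using potential_unbounded[OF c] by blast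
    have le: "v t \<le> M" if "t < a" for t
      using M[of "v t"] E[OF that] zero_le_power2[of "v' t"] by linarith
    have dec: "v t \<le> v s" if "s \<le> t" "t < a" for s t
    proof (rule DERIV_nonpos_imp_nonincreasing[OF that(1)])
      fix x assume "s \<le> x" "x \<le> t"
      then have "x < a" using that by simp
      then show "\<exists>y. (v has_real_derivative y) (at x) \<and> y \<le> 0"
        using D(2) sg False by (metis abs_ge_zero mult_minus1 neg_le_0_iff_le)
    qed
    have "\<exists>L. ((\<lambda>t. - v t) \<longlongrightarrow> L) at_bot"
      by (rule increasing_bounded_tendsto_at_bot[of a "\<lambda>t. - v t" "- M"]) (use le dec in auto)
    then obtain L where L: "((\<lambda>t. - v t) \<longlongrightarrow> L) at_bot" by blast
    from tendsto_minus[OF L] have L': "(v \<longlongrightarrow> - L) at_bot" by simp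
    moreover have "0 \<le> - L"
      by (rule tendsto_lowerbound[OF L' ev_pos]) simp
    ultimately show ?thesis by blast
  qed
  then obtain L where L: "0 \<le> L" "(v \<longlongrightarrow> L) at_bot" by blast
  have pw: "((\<lambda>t. v t powr q) \<longlongrightarrow> L powr q) at_bot" if "0 < q" for q
    by (rule tendsto_powr'[OF L(2) tendsto_const]) (use that ev_pos in auto)
  have pot: "((\<lambda>t. potential c (v t)) \<longlongrightarrow> potential c L) at_bot"
    unfolding potential_def using c by (intro tendsto_intros L pw) (auto intro: add_pos_pos)
  have "((\<lambda>t. \<sigma> * sqrt (2 * (E - potential c (v t)))) \<longlongrightarrow> \<sigma> * sqrt (2 * (E - potential c L))) at_bot"
    by (intro tendsto_intros pot)
  moreover have ev: "\<forall>\<^sub>F t in at_bot. \<sigma> * sqrt (2 * (E - potential c (v t))) = v' t"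
    using eventually_gt_at_bot[of a]
  proof eventually_elim
    case (elim t)
    have "2 * (E - potential c (v t)) = (v' t)\<^sup>2" using E[OF elim] by (simp add: field_simps)
    then show ?case using sg(1)[OF elim] by simp
  qed
  ultimately have v'lim: "(v' \<longlongrightarrow> \<sigma> * sqrt (2 * (E - potential c L))) at_bot"
    by (rule Lim_transform_eventually)
  then have "\<sigma> * sqrt (2 * (E - potential c L)) = 0"
    using deriv_limit_at_bot_zero[of a v v'] D(2) L(2) by blast
  with v'lim sg(2) have EL: "E = potential c L" and v'0: "(v' \<longlongrightarrow> 0) at_bot" by auto
  have "((\<lambda>t. c\<^sup>2 * v t - v t powr (1 + 2 / c)) \<longlongrightarrow> c\<^sup>2 * L - L powr (1 + 2 / c)) at_bot"
    using c by (intro tendsto_intros L pw) (auto intro: add_pos_pos)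
  then have crit: "c\<^sup>2 * L - L powr (1 + 2 / c) = 0"
    using deriv_limit_at_bot_zero[of a v' "\<lambda>t. c\<^sup>2 * v t - v t powr (1 + 2 / c)"] D(3) v'0 by blast
  have "L = 0"
  proof (rule ccontr)
    assume "L \<noteq> 0"
    then have "0 < L" using L by simp
    then have "L = c powr c" using crit force_sign[OF c, of L] by auto
    have t: "a - 1 < a" by simp
    have "(v' (a - 1))\<^sup>2 \<le> 0"
      using E[OF t] EL potential_minimum[OF c D(1)[OF t]] unfolding \<open>L = c powr c\<close> by linarith
    then show False using nz[OF t] by simp
  qed
  then show "E = 0" using EL by (simp add: potential_def)
qed

text \<open>
  The substitution \<open>z = v\<^sup>-\<^sup>1\<^sup>/\<^sup>c\<close> turns the energy identity into \<open>z\<^sup>2 - z'\<^sup>2 = 1 / (c (c + 1))\<close> and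
  the equation into \<open>z'' = z\<close>.  The product of the two coefficients is read off from the former; its
  positivity, with \<open>z > 0\<close>, makes both coefficients positive.
\<close>

lemma profile_energy_zero:
  assumes c: "0 < c" and v: "profile_on c I v v'" and I: "is_interval I" "I \<noteq> {}"
    and E: "\<And>t. t \<in> I \<Longrightarrow> (v' t)\<^sup>2 / 2 + potential c (v t) = 0"
  obtains \<alpha> \<beta> where "0 < \<alpha>" "0 < \<beta>" "4 * \<alpha> * \<beta> = 1 / (c * (c + 1))"
    "\<And>t. t \<in> I \<Longrightarrow> v t = (\<alpha> * exp t + \<beta> * exp (- t)) powr (- c)"
proof -
  define z where "z = (\<lambda>t. v t powr (- 1 / c))"
  define z' where "z' = (\<lambda>t. - (1 / c) * z t * v' t / v t)"
  have zpos: "0 < z t" if "t \<in> I" for t using profile_onD(1)[OF v that] by (simp add: z_def)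
  have vz: "v t = z t powr (- c)" if "t \<in> I" for t
    using profile_onD(1)[OF v that] c by (simp add: z_def powr_powr)
  have pw: "v t powr (1 + 2 / c) = v t / (z t)\<^sup>2" "v t powr (2 + 2 / c) = (v t)\<^sup>2 / (z t)\<^sup>2"
    if "t \<in> I" for t
  proof -
    have x: "0 < v t" using profile_onD(1)[OF v that] .
    have "v t powr (2 / c) * (z t)\<^sup>2 = 1"
      using x c by (simp add: z_def power2_eq_square flip: powr_add)
    then have y: "v t powr (2 / c) = 1 / (z t)\<^sup>2" using zpos[OF that] by (simp add: field_simps)
    show "v t powr (1 + 2 / c) = v t / (z t)\<^sup>2" "v t powr (2 + 2 / c) = (v t)\<^sup>2 / (z t)\<^sup>2"
      using x by (simp_all add: powr_add y)
  qed
  have v'2: "(v' t)\<^sup>2 = c\<^sup>2 * (v t)\<^sup>2 - c / (c + 1) * (v t)\<^sup>2 / (z t)\<^sup>2" if "t \<in> I" for t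
  proof -
    define P where "P = c / (c + 1) * (v t)\<^sup>2 / (z t)\<^sup>2"
    have "c / (2 * (c + 1)) * ((v t)\<^sup>2 / (z t)\<^sup>2) = P / 2" by (simp add: P_def)
    then have "(v' t)\<^sup>2 / 2 + (P / 2 - c\<^sup>2 * (v t)\<^sup>2 / 2) = 0"
      using E[OF that] unfolding potential_def pw[OF that] by metis
    then show ?thesis unfolding P_def[symmetric] by simp
  qed
  have zz': "(z t)\<^sup>2 - (z' t)\<^sup>2 = 1 / (c * (c + 1))" if "t \<in> I" for t
  proof -
    have "(z' t)\<^sup>2 = (z t)\<^sup>2 * (v' t)\<^sup>2 / (c\<^sup>2 * (v t)\<^sup>2)"
      by (simp add: z'_def power_mult_distrib power_divide)
    also have "\<dots> = (z t)\<^sup>2 - 1 / (c * (c + 1))"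
    proof -
      have "x\<^sup>2 * (c\<^sup>2 * y\<^sup>2 - c / d * y\<^sup>2 / x\<^sup>2) / (c\<^sup>2 * y\<^sup>2) = x\<^sup>2 - 1 / (c * d)"
        if "0 < x" "0 < y" "0 < d" for x y d :: real
        using that c by (simp add: field_simps power2_eq_square)
      then show ?thesis
        unfolding v'2[OF that] using zpos[OF that] profile_onD(1)[OF v that] c by simp
    qed
    finally show ?thesis by simp
  qed
  have Dz: "(z has_real_derivative z' t) (at t)" if "t \<in> I" for t
  proof -
    note D = profile_onD[OF v that]
    have "(z has_real_derivative (- 1 / c) * v t powr (- 1 / c - 1) * v' t) (at t)"
      unfolding z_def using D(1,2) by (auto intro!: derivative_eq_intros)
    then show ?thesis
      using D(1) by (simp add: z'_def z_def powr_diff field_simps)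
  qed
  have Dz': "(z' has_real_derivative z t) (at t)" if "t \<in> I" for t
  proof -
    note D = profile_onD[OF v that]
    define r where "r = (\<lambda>t. v' t / v t)"
    have z'r: "z' = (\<lambda>t. - (1 / c) * (z t * r t))" by (simp add: z'_def r_def fun_eq_iff)
    have "(r t)\<^sup>2 = (v' t)\<^sup>2 / (v t)\<^sup>2" by (simp add: r_def power_divide)
    also have "\<dots> = c\<^sup>2 - c / (c + 1) / (z t)\<^sup>2"
      unfolding v'2[OF that] using D(1) by (simp add: diff_divide_distrib)
    finally have r2: "(r t)\<^sup>2 = c\<^sup>2 - c / (c + 1) / (z t)\<^sup>2" .
    have "(r has_real_derivative
        ((c\<^sup>2 * v t - v t powr (1 + 2 / c)) * v t - v' t * v' t) / (v t * v t)) (at t)"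
      unfolding r_def using D by (intro DERIV_divide) auto
    also have "((c\<^sup>2 * v t - v t powr (1 + 2 / c)) * v t - v' t * v' t) / (v t * v t)
        = c\<^sup>2 - 1 / (z t)\<^sup>2 - (r t)\<^sup>2"
      unfolding pw[OF that] r_def using D(1) zpos[OF that]
      by (simp add: diff_divide_distrib power2_eq_square left_diff_distrib)
    finally have "(z' has_real_derivative
        - (1 / c) * (z' t * r t + (c\<^sup>2 - 1 / (z t)\<^sup>2 - (r t)\<^sup>2) * z t)) (at t)"
      unfolding z'r by (intro DERIV_cmult DERIV_mult Dz[OF that, unfolded z'r])
    also have "- (1 / c) * (z' t * r t + (c\<^sup>2 - 1 / (z t)\<^sup>2 - (r t)\<^sup>2) * z t)
        = z t * ((r t)\<^sup>2 * (1 / c\<^sup>2 + 1 / c) - c + 1 / c / (z t)\<^sup>2)"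
      unfolding z'r using c by (simp add: algebra_simps power2_eq_square)
    also have "(r t)\<^sup>2 * (1 / c\<^sup>2 + 1 / c) - c + 1 / c / (z t)\<^sup>2 = 1"
    proof -
      have "(c\<^sup>2 - c / (c + 1) * x) * (1 / c\<^sup>2 + 1 / c) - c + 1 / c * x = 1" for x
      proof -
        have "c / (c + 1) * (1 / c\<^sup>2 + 1 / c) = 1 / c"
          using c by (simp add: divide_simps) (simp add: algebra_simps power2_eq_square)
        moreover have "c\<^sup>2 * (1 / c\<^sup>2 + 1 / c) = 1 + c"
          using c by (simp add: field_simps power2_eq_square)
        moreover have "(p - d * x) * k = p * k - (d * k) * x" for p d k :: real
          by (simp add: algebra_simps)
        ultimately have "(c\<^sup>2 - c / (c + 1) * x) * (1 / c\<^sup>2 + 1 / c) = (1 + c) - 1 / c * x" by metis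
        then show ?thesis by simp
      qed
      from this[of "1 / (z t)\<^sup>2"] show ?thesis unfolding r2 by simp
    qed
    finally show ?thesis by simp
  qed
  have cvx: "convex I" using I by (simp add: is_interval_convex)
  \<comment> \<open>The two first integrals of \<open>z'' = z\<close>.\<close>
  have "((\<lambda>t. (z t + z' t) * exp (- t)) has_real_derivative 0) (at t)"
    "((\<lambda>t. (z t - z' t) * exp t) has_real_derivative 0) (at t)" if "t \<in> I" for t
    by ((rule derivative_eq_intros Dz Dz' that refl | simp)+; simp add: algebra_simps)+
  then have "\<exists>A. \<forall>t\<in>I. (z t + z' t) * exp (- t) = A" "\<exists>B. \<forall>t\<in>I. (z t - z' t) * exp t = B"
    by (auto intro!: has_field_derivative_zero_constant[OF cvx] intro: has_field_derivative_at_within)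
  then obtain A B where AB: "\<And>t. t \<in> I \<Longrightarrow> (z t + z' t) * exp (- t) = A"
    "\<And>t. t \<in> I \<Longrightarrow> (z t - z' t) * exp t = B" by blast
  have z: "z t = A / 2 * exp t + B / 2 * exp (- t)" if "t \<in> I" for t
  proof -
    have "A * exp t = z t + z' t" "B * exp (- t) = z t - z' t"
      using AB[OF that, symmetric] by (simp_all add: mult.assoc flip: exp_add)
    then show ?thesis by (simp add: field_simps)
  qed
  obtain s where s: "s \<in> I" using I by blast
  have "A * B = (z s)\<^sup>2 - (z' s)\<^sup>2"
    unfolding AB(1)[OF s, symmetric] AB(2)[OF s, symmetric]
    by (simp add: exp_minus field_simps power2_eq_square)
  then have prod: "4 * (A / 2) * (B / 2) = 1 / (c * (c + 1))" using zz'[OF s] by simp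
  have "0 < A * B" using \<open>A * B = _\<close> zz'[OF s] c by simp
  moreover have "\<not> (A < 0 \<and> B < 0)"
  proof
    assume "A < 0 \<and> B < 0"
    then have "A / 2 * exp s < 0" "B / 2 * exp (- s) < 0" by (auto simp: mult_less_0_iff)
    then show False using z[OF s] zpos[OF s] by linarith
  qed
  ultimately have "0 < A / 2" "0 < B / 2" by (auto simp: zero_less_mult_iff)
  then show ?thesis using that prod vz z by metis
qed

section \<open>Classification of the profiles\<close>

lemma constant_profile:
  assumes c: "0 < c" and W: "profile_on c UNIV W W'" and k: "W constant_on UNIV"
  shows "W t = c powr c"
proof -
  obtain k where k: "W = (\<lambda>_. k)" using k by (auto simp: constant_on_def)
  note D = profile_onD[OF W UNIV_I]
  have "W' = (\<lambda>_. 0)"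
    using D(2) DERIV_const DERIV_unique unfolding k by blast
  then have "c\<^sup>2 * W t - W t powr (1 + 2 / c) = 0"
    using D(3)[of t] DERIV_const DERIV_unique by metis
  then show ?thesis using force_sign[OF c D(1), of t] by auto
qed

text \<open>
  The case distinction is whether \<open>v'\<close> has two zeros.  If it has at most one, then it has none to the
  left of some \<open>a\<close>, which determines the energy of the whole solution.
\<close>

lemma profile_half_line_cases:
  assumes c: "0 < c" and v: "profile_on c {..<B} v v'"
  obtains (equilibrium) "\<And>t. t < B \<Longrightarrow> v t = c powr c"
  | (periodic) W W' \<tau> where "profile_on c UNIV W W'" "0 < \<tau>" "is_period W \<tau>"
      "\<not> W constant_on UNIV" "\<And>t. t < B \<Longrightarrow> v t = W t"
  | (homoclinic) \<alpha> \<beta> where "0 < \<alpha>" "0 < \<beta>" "4 * \<alpha> * \<beta> = 1 / (c * (c + 1))"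
      "\<And>t. t < B \<Longrightarrow> v t = (\<alpha> * exp t + \<beta> * exp (- t)) powr (- c)"
proof (cases "\<exists>s s'. s < s' \<and> s' < B \<and> v' s = 0 \<and> v' s' = 0")
  case True
  then obtain s s' where s: "s < s'" "s' < B" "v' s = 0" "v' s' = 0" by blast
  obtain W W' where W: "profile_on c UNIV W W'" "\<And>t. t < B \<Longrightarrow> W t = v t \<and> W' t = v' t"
    using profile_critical_extension[OF c v s(2,4)] by metis
  have per: "is_period W (2 * (s' - s))"
    using profile_periodic[OF c W(1)] W(2) s by simp
  show ?thesis
  proof (cases "W constant_on UNIV")
    case True
    then show ?thesis using equilibrium constant_profile[OF c W(1)] W(2) by metis
  next
    case False
    then show ?thesis using periodic[OF W(1) _ per] s W(2) by simp
  qed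
next
  case False
  obtain a where a: "a \<le> B" "\<And>t. t < a \<Longrightarrow> v' t \<noteq> 0"
  proof (cases "\<exists>s<B. v' s = 0")
    case True
    then obtain s where "s < B" "v' s = 0" by blast
    then show ?thesis using that[of s] False by force
  next
    case False
    then show ?thesis using that[of B] by blast
  qed
  have I: "is_interval {..<B}" by (simp add: is_interval_ci)
  obtain E where E: "\<And>t. t < B \<Longrightarrow> (v' t)\<^sup>2 / 2 + potential c (v t) = E"
    using profile_energy[OF c I v] by auto
  have va: "profile_on c {..<a} v v'" using v a by (auto intro: profile_on_subset)
  have "E = 0" using profile_monotone_energy_zero[OF c va a(2)] E a(1) by force
  moreover have "{..<B} \<noteq> {}" using lt_ex[of B] by blast
  ultimately show ?thesis
    using profile_energy_zero[OF c v I] E homoclinic by (metis lessThan_iff)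
qed

lemma is_period_multiple:
  assumes "is_period f T"
  shows "f (t + of_int k * T) = f t"
proof -
  have nat: "f (t + real n * T) = f t" for n t
  proof (induction n)
    case (Suc n)
    have "f (t + real (Suc n) * T) = f ((t + real n * T) + T)" by (simp add: algebra_simps)
    also have "\<dots> = f (t + real n * T)" using assms unfolding is_period_def by blast
    finally show ?case using Suc by simp
  qed simp
  show ?thesis
  proof (cases "0 \<le> k")
    case True
    then show ?thesis using nat[of t "nat k"] by simp
  next
    case False
    then show ?thesis using nat[of "t + of_int k * T" "nat (- k)"] by simp
  qed
qed

text \<open>
  Choosing for \<open>T\<close> the least period, this produces the phase in \<open>[0, T_b)\<close>.
\<close>

lemma is_period_reduce:
  assumes "is_period f T" "0 < T"
  obtains s where "0 \<le> s" "s < T" "\<And>x. f (x + s) = f (x + t)"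
proof
  show "0 \<le> t + of_int (- \<lfloor>t / T\<rfloor>) * T" "t + of_int (- \<lfloor>t / T\<rfloor>) * T < T"
    using floor_divide_lower[OF assms(2), of t] floor_divide_upper[OF assms(2), of t]
    by (simp_all add: algebra_simps)
  show "f (x + (t + of_int (- \<lfloor>t / T\<rfloor>) * T)) = f (x + t)" for x
    using is_period_multiple[OF assms(1), of "x + t" "- \<lfloor>t / T\<rfloor>"] by (simp add: algebra_simps)
qed

text \<open>
  The periods of a continuous function form a closed set, so the infimum of the positive periods is
  a period.  It is positive: with arbitrarily short periods every value would occur arbitrarily close
  to zero, and the function would be constant.
\<close>

lemma least_period_exists:
  fixes f :: "real \<Rightarrow> real"
  assumes cont: "continuous_on UNIV f" and \<tau>: "is_period f \<tau>" "0 < \<tau>"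
    and nc: "\<not> f constant_on UNIV"
  obtains T where "0 < T" "is_period f T" "\<And>S. 0 < S \<Longrightarrow> is_period f S \<Longrightarrow> T \<le> S"
proof -
  define P where "P = {T. 0 < T \<and> is_period f T}"
  have ne: "P \<noteq> {}" using \<tau> by (auto simp: P_def)
  have bdd: "bdd_below P" by (auto simp: P_def intro!: bdd_belowI[of _ 0])
  have "closed {T. is_period f T}"
    unfolding is_period_def
    by (intro closed_Collect_all closed_Collect_eq continuous_intros
        continuous_on_compose2[OF cont]) auto
  moreover have "P \<subseteq> {T. is_period f T}" by (auto simp: P_def)
  ultimately have per: "is_period f (Inf P)"
    using closure_contains_Inf[OF ne bdd] closure_minimal by blast
  have le: "Inf P \<le> S" if "0 < S" "is_period f S" for S
    using that bdd by (auto simp: P_def intro!: cInf_lower)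
  have "0 \<le> Inf P" using ne by (intro cInf_greatest) (auto simp: P_def)
  moreover have "Inf P \<noteq> 0"
  proof
    assume zero: "Inf P = 0"
    have "f x = f 0" for x
    proof (rule ccontr)
      assume "f x \<noteq> f 0"
      then have "0 < dist (f x) (f 0)" by simp
      then obtain d where d: "0 < d" "\<And>y. dist y 0 < d \<Longrightarrow> dist (f y) (f 0) < dist (f x) (f 0)"
        using cont unfolding continuous_on_iff by (metis UNIV_I)
      then obtain S where S: "S \<in> P" "S < d" using cInf_less_iff[OF ne bdd] zero by metis
      obtain s where s: "0 \<le> s" "s < S" "\<And>y. f (y + s) = f (y + x)"
        using is_period_reduce[of f S x] S(1) by (auto simp: P_def)
      have "dist s 0 < d" using s S by simp
      then show False using d(2)[of s] s(3)[of 0] by simp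
    qed
    then show False using nc by (auto simp: constant_on_def)
  qed
  ultimately show ?thesis using that[of "Inf P"] per le by simp
qed

lemma profile_solution_iff:
  assumes N: "2 < N" and c: "c = (real N - 2) / 2"
  shows "profile_solution N v \<and> (\<forall>t. 0 < v t) \<longleftrightarrow> (\<exists>v'. profile_on c UNIV v v')"
proof -
  have e: "(real N + 2) / (real N - 2) = 1 + 2 / c" "(real N - 2)\<^sup>2 / 4 = c\<^sup>2"
    using N unfolding c by (auto simp: field_simps power2_eq_square)
  show ?thesis
  proof
    assume L: "profile_solution N v \<and> (\<forall>t. 0 < v t)"
    then obtain v' v'' where D: "\<And>t. (v has_real_derivative v' t) (at t)"
      "\<And>t. (v' has_real_derivative v'' t) (at t)"
      "\<And>t. v'' t - c\<^sup>2 * v t + v t powr (1 + 2 / c) = 0"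
      unfolding profile_solution_def e by blast
    have "v'' t = c\<^sup>2 * v t - v t powr (1 + 2 / c)" for t using D(3)[of t] by simp
    then show "\<exists>v'. profile_on c UNIV v v'" using D L unfolding profile_on_def by metis
  next
    assume "\<exists>v'. profile_on c UNIV v v'"
    then obtain v' where v: "profile_on c UNIV v v'" by blast
    note D = profile_onD[OF v UNIV_I]
    have "profile_solution N v" unfolding profile_solution_def e
      by (rule exI[of _ v'], rule exI[of _ "\<lambda>t. c\<^sup>2 * v t - v t powr (1 + 2 / c)"])
        (use D in auto)
    then show "profile_solution N v \<and> (\<forall>t. 0 < v t)" using D(1) by blast
  qed
qed

lemma profile_deriv_zero_at_minimum:
  assumes v: "profile_on c UNIV v v'" and m: "\<And>t. v s \<le> v t"
  shows "v' s = 0"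
  using DERIV_local_min[OF profile_onD(2)[OF v UNIV_I], of 1 s] m by simp

text \<open>
  The definite description defining \<open>v_per\<close> is met by translating a minimum of \<open>W\<close> to the origin: a
  competitor also has a critical point at zero, hence the same initial data.  The bound
  \<open>b < v_0 N\<close> holds because the potential increases to the right of its minimum point \<open>v_0 N\<close>; were
  \<open>b\<close> at least \<open>v_0 N\<close>, the potential energy would be least where the velocity vanishes, so the
  velocity would vanish everywhere.
\<close>

lemma periodic_profile_is_v_per:
  assumes N: "2 < N" and c: "c = (real N - 2) / 2"
    and W: "profile_on c UNIV W W'" and \<tau>: "is_period W \<tau>" "0 < \<tau>"
    and nc: "\<not> W constant_on UNIV"
  obtains b T where "0 < b" "b < v_0 N" "0 \<le> T" "T < T_per N b" "\<And>t. W t = v_per N b (t + T)"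
proof -
  have c0: "0 < c" using N c by simp
  have "continuous_on {0..\<tau>} W"
    using profile_onD(2)[OF W UNIV_I] by (meson DERIV_isCont continuous_at_imp_continuous_on)
  then have "\<exists>m\<in>{0..\<tau>}. \<forall>t\<in>{0..\<tau>}. W m \<le> W t"
    using \<tau>(2) by (intro continuous_attains_inf) auto
  then obtain m where m: "\<And>t. t \<in> {0..\<tau>} \<Longrightarrow> W m \<le> W t" by blast
  have min: "W m \<le> W t" for t
  proof -
    obtain s where "0 \<le> s" "s < \<tau>" "\<And>x. W (x + s) = W (x + t)"
      using is_period_reduce[OF \<tau>] by metis
    then show ?thesis using m[of s] by (metis add_0 atLeastAtMost_iff less_imp_le)
  qed
  define X X' b where "X = (\<lambda>t. W (t + m))" and "X' = (\<lambda>t. W' (t + m))" and "b = W m"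
  have WX: "W t = X (t + - m)" for t by (simp add: X_def)
  have X: "profile_on c UNIV X X'"
    unfolding X_def X'_def by (rule profile_on_subset[OF profile_on_shift[OF W]]) auto
  have X0: "X 0 = b" "\<And>t. b \<le> X t" using min by (auto simp: X_def b_def)
  have X'0: "X' 0 = 0" by (rule profile_deriv_zero_at_minimum[OF X]) (use X0 in simp)
  have Xper: "is_period X \<tau>"
    using \<tau>(1) unfolding is_period_def X_def by (metis add.assoc add.commute)
  have Xnc: "\<not> X constant_on UNIV"
    using nc WX unfolding constant_on_def by (metis UNIV_I)
  have Inf: "X 0 = (INF t. X t)"
    using X0 by (intro antisym cINF_greatest) (auto intro!: cINF_lower2[of _ _ 0] bdd_belowI)
  have v_per: "v_per N b = X"
    unfolding v_per_def
  proof (rule the_equality)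
    show "profile_solution N X \<and> (\<forall>t. 0 < X t) \<and> \<not> X constant_on UNIV \<and>
        (\<exists>T>0. is_period X T) \<and> X 0 = (INF t. X t) \<and> X 0 = b"
      using profile_solution_iff[OF N c] X Xnc Xper \<tau>(2) Inf X0(1) by metis
  next
    fix Y
    assume Y: "profile_solution N Y \<and> (\<forall>t. 0 < Y t) \<and> \<not> Y constant_on UNIV \<and>
        (\<exists>T>0. is_period Y T) \<and> Y 0 = (INF t. Y t) \<and> Y 0 = b"
    then obtain Y' where Y': "profile_on c UNIV Y Y'" using profile_solution_iff[OF N c] by metis
    have "bdd_below (range Y)" using Y by (auto intro!: bdd_belowI[of _ 0] less_imp_le)
    then have "Y 0 \<le> Y t" for t using Y by (metis UNIV_I cINF_lower)
    then have "Y' 0 = 0" by (rule profile_deriv_zero_at_minimum[OF Y'])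
    then show "Y = X"
      using profile_unique(1)[OF c0 is_interval_univ UNIV_I Y' X, of 0] Y X0(1) X'0 by auto
  qed
  have b0: "0 < b" using profile_onD(1)[OF W UNIV_I] by (simp add: b_def)
  have bv: "b < c powr c"
  proof (rule ccontr)
    assume "\<not> b < c powr c"
    then have pot: "potential c b \<le> potential c (X t)" for t
      using potential_mono[OF c0] X0(2) by simp
    obtain E where E: "\<And>t. (X' t)\<^sup>2 / 2 + potential c (X t) = E"
      using profile_energy[OF c0 is_interval_univ X] by auto
    have "E = potential c b" using E[of 0] X0(1) X'0 by simp
    then have "(X' t)\<^sup>2 \<le> 0" for t using pot[of t] E[of t] by linarith
    then have "X' t = 0" for t by simp
    then have "X t = X 0" for t
      using profile_onD(2)[OF X UNIV_I] DERIV_isconst_all by metis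
    then show False using Xnc by (auto simp: constant_on_def)
  qed
  have contX: "continuous_on UNIV X"
    using profile_onD(2)[OF X UNIV_I] by (meson DERIV_isCont continuous_at_imp_continuous_on)
  obtain T0 where T0: "0 < T0" "is_period X T0" "\<And>S. 0 < S \<Longrightarrow> is_period X S \<Longrightarrow> T0 \<le> S"
    using least_period_exists[OF contX Xper \<tau>(2) Xnc] by blast
  have T_per: "T_per N b = T0"
    unfolding T_per_def v_per by (rule Least_equality) (use T0 in auto)
  obtain T where T: "0 \<le> T" "T < T0" "\<And>x. X (x + T) = X (x + - m)"
    using is_period_reduce[OF T0(2,1)] by metis
  show ?thesis
    by (rule that[of b T]) (use b0 bv T WX in \<open>simp_all add: v_0_def c T_per v_per\<close>)
qed

section \<open>The cylindrical variable\<close>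

text \<open>
  The hypothesis \<open>ode\<close> is the radial equation in the variable \<open>y = cosh r\<close>, in dimension
  \<open>2 c + 2\<close>.  With \<open>s = ln (tanh (r / 2))\<close> one has \<open>y = cosh s / sinh (- s)\<close> and
  \<open>sinh r = 1 / sinh (- s)\<close>, and the weight \<open>(sinh r)\<^sup>c\<close> removes the first order term.
\<close>

lemma cylinder_profile:
  assumes c: "0 < c"
    and F: "\<And>y. 1 < y \<Longrightarrow> (F has_real_derivative F1 y) (at y)"
    and F1: "\<And>y. 1 < y \<Longrightarrow> (F1 has_real_derivative F2 y) (at y)"
    and pos: "\<And>y. 1 < y \<Longrightarrow> 0 < F y"
    and ode: "\<And>y. 1 < y \<Longrightarrow>
      (y\<^sup>2 - 1) * F2 y + (2 * c + 2) * y * F1 y + c * (c + 1) * F y + F y powr (1 + 2 / c) = 0"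
  obtains V' where
    "profile_on c {..<0} (\<lambda>s. sinh (- s) powr (- c) * F (cosh s / sinh (- s))) V'"
proof -
  let ?S = "\<lambda>s :: real. sinh (- s)" and ?y = "\<lambda>s :: real. cosh s / sinh (- s)"
  let ?V = "\<lambda>s. ?S s powr (- c) * F (?y s)"
  let ?V' = "\<lambda>s. c * (cosh s * (?S s powr (- c - 1) * F (?y s))) + ?S s powr (- c - 2) * F1 (?y s)"
  have "0 < ?V s \<and> (?V has_real_derivative ?V' s) (at s) \<and>
      (?V' has_real_derivative (c\<^sup>2 * ?V s - ?V s powr (1 + 2 / c))) (at s)" if "s < 0" for s
  proof -
    define S C y where "S = ?S s" and "C = cosh s" and "y = ?y s"
    have S: "0 < S" using that by (simp add: S_def)
    have C2: "C\<^sup>2 = S\<^sup>2 + 1" by (simp add: C_def S_def cosh_square_eq)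
    have "S\<^sup>2 < C\<^sup>2" using C2 by simp
    moreover have "0 \<le> C" by (simp add: C_def)
    ultimately have "S < C" by (rule power_less_imp_less_base)
    have yC: "y = C / S" by (simp add: y_def S_def C_def)
    then have y: "1 < y" using S \<open>S < C\<close> by simp
    have DS: "(?S has_real_derivative - C) (at s)"
      by (auto intro!: derivative_eq_intros simp: C_def)
    have DC: "(cosh has_real_derivative - S) (at s)"
      by (auto intro!: derivative_eq_intros simp: S_def)
    have "(?y has_real_derivative (- S * S - C * (- C)) / (S * S)) (at s)"
      unfolding S_def C_def
      by (rule DERIV_divide[OF DC[unfolded S_def] DS[unfolded C_def]]) (use S in \<open>simp add: S_def\<close>)
    also have "(- S * S - C * (- C)) / (S * S) = S powr (- 2)"
      using C2 S by (simp add: powr_minus powr_numeral power2_eq_square field_simps)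
    finally have Dy: "(?y has_real_derivative S powr (- 2)) (at s)" .
    have DSp: "((\<lambda>s. ?S s powr q) has_real_derivative - q * C * S powr (q - 1)) (at s)" for q
      using DERIV_fun_powr[OF DS, of q] S by (simp add: S_def mult_ac)
    have DF: "((\<lambda>s. F (?y s)) has_real_derivative F1 y * S powr (- 2)) (at s)"
      using DERIV_chain2[where f = F, OF _ Dy] F[OF y] by (simp add: y_def)
    have DF1: "((\<lambda>s. F1 (?y s)) has_real_derivative F2 y * S powr (- 2)) (at s)"
      using DERIV_chain2[where f = F1, OF _ Dy] F1[OF y] by (simp add: y_def)
    have pw: "S powr (- c - 1) = S powr (- c) / S" "S powr (- c - 2) = S powr (- c) / S^2"
      "S powr (- 2) = 1 / S^2" "S powr (- c - 1 - 1) = S powr (- c) / S^2"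
      "S powr (- c - 2 - 1) = S powr (- c) / S^3"
      using S by (simp_all add: powr_diff powr_minus powr_numeral field_simps power2_eq_square power3_eq_cube)
    define P where "P = S powr (- c)"
    have D1: "(?V has_real_derivative ?V' s) (at s)"
    proof -
      have "(?V has_real_derivative (- (- c) * C * S powr (- c - 1)) * F y + (F1 y * S powr (- 2)) * S powr (- c)) (at s)"
        using DERIV_mult[OF DSp[of "- c"] DF] by (simp add: S_def y_def)
      also have "(- (- c) * C * S powr (- c - 1)) * F y + (F1 y * S powr (- 2)) * S powr (- c)
          = c * (C * (S powr (- c - 1) * F y)) + S powr (- c - 2) * F1 y"
        unfolding pw by (simp add: mult_ac)
      finally show ?thesis by (simp add: S_def C_def y_def)
    qed
    have "(?V' has_real_derivative
        c * (- S * (S powr (- c - 1) * F y) + ((- (- c - 1) * C * S powr (- c - 1 - 1)) * F y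
          + (F1 y * S powr (- 2)) * S powr (- c - 1)) * C)
        + ((- (- c - 2) * C * S powr (- c - 2 - 1)) * F1 y + (F2 y * S powr (- 2)) * S powr (- c - 2))) (at s)"
      using DERIV_add[OF DERIV_cmult[OF DERIV_mult[OF DC DERIV_mult[OF DSp[of "- c - 1"] DF]], of c]
          DERIV_mult[OF DSp[of "- c - 2"] DF1]]
      by (simp add: S_def y_def C_def)
    also have "c * (- S * (S powr (- c - 1) * F y) + ((- (- c - 1) * C * S powr (- c - 1 - 1)) * F y
          + (F1 y * S powr (- 2)) * S powr (- c - 1)) * C)
        + ((- (- c - 2) * C * S powr (- c - 2 - 1)) * F1 y + (F2 y * S powr (- 2)) * S powr (- c - 2))
        = c\<^sup>2 * (P * F y) + P / S\<^sup>2 * (c * (c + 1) * F y + (2 * c + 2) * (C / S) * F1 y + F2 y / S\<^sup>2)"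
    proof -
      have "c * (- S * (P / S * f) + ((- (- c - 1) * C * (P / S\<^sup>2)) * f + (f1 * (1 / S\<^sup>2)) * (P / S)) * C)
          + ((- (- c - 2) * C * (P / S^3)) * f1 + (f2 * (1 / S\<^sup>2)) * (P / S\<^sup>2))
        = - c * P * f + c * (c + 1) * P * f * C\<^sup>2 / S\<^sup>2 + (2 * c + 2) * C * P * f1 / S^3 + P * f2 / S^4"
        for f f1 f2
        using S by (simp add: field_simps power2_eq_square power3_eq_cube power4_eq_xxxx)
      also have "- c * P * f + c * (c + 1) * P * f * C\<^sup>2 / S\<^sup>2 + (2 * c + 2) * C * P * f1 / S^3 + P * f2 / S^4
        = c\<^sup>2 * (P * f) + P / S\<^sup>2 * (c * (c + 1) * f + (2 * c + 2) * (C / S) * f1 + f2 / S\<^sup>2)" for f f1 f2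
        unfolding C2 using S
        by (simp add: field_simps power2_eq_square power3_eq_cube power4_eq_xxxx)
      finally show ?thesis unfolding pw P_def .
    qed
    also have "c * (c + 1) * F y + (2 * c + 2) * (C / S) * F1 y + F2 y / S\<^sup>2 = - (F y powr (1 + 2 / c))"
    proof -
      have "y\<^sup>2 - 1 = 1 / S\<^sup>2" unfolding yC power_divide C2 using S by (simp add: field_simps)
      then show ?thesis using ode[OF y] unfolding yC by simp
    qed
    also have "c\<^sup>2 * (P * F y) + P / S\<^sup>2 * - (F y powr (1 + 2 / c)) = c\<^sup>2 * (P * F y) - (P * F y) powr (1 + 2 / c)"
    proof -
      have "P powr (1 + 2 / c) = S powr (- c - 2)"
      proof -
        have "- c * (1 + 2 / c) = - c - 2" using c by (simp add: distrib_left)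
        then show ?thesis unfolding P_def powr_powr by simp
      qed
      then have "(P * F y) powr (1 + 2 / c) = P / S\<^sup>2 * F y powr (1 + 2 / c)"
        using pos[OF y] pw(2) by (simp add: powr_mult P_def)
      then show ?thesis by simp
    qed
    finally have D2: "(?V' has_real_derivative c\<^sup>2 * ?V s - ?V s powr (1 + 2 / c)) (at s)"
      by (simp add: P_def S_def y_def)
    have "0 < ?V s" using S pos[OF y] by (simp add: S_def y_def)
    with D1 D2 show ?thesis by blast
  qed
  then have "profile_on c {..<0} ?V ?V'" unfolding profile_on_def by blast
  then show ?thesis by (rule that)
qed

section \<open>The hyperbolic cosine of the distance\<close>

text \<open>
  Working with \<open>cosh r\<close> in place of \<open>r\<close> keeps everything rational, and smooth at \<open>Q\<close>.
\<close>

definition cosh_dist :: "real^'n::finite \<Rightarrow> real^'n \<Rightarrow> real" where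
  "cosh_dist Q x = 1 + 2 * ((x - Q) \<bullet> (x - Q)) / ((1 - x \<bullet> x) * (1 - Q \<bullet> Q))"

text \<open>
  The gradient and, below, the Hessian of \<open>cosh_dist Q\<close> with respect to the Euclidean metric.
\<close>

definition grad_cosh_dist :: "real^'n::finite \<Rightarrow> real^'n \<Rightarrow> real^'n" where
  "grad_cosh_dist Q x = (4 / (1 - Q \<bullet> Q)) *\<^sub>R
     ((1 / (1 - x \<bullet> x)) *\<^sub>R (x - Q) + (((x - Q) \<bullet> (x - Q)) / (1 - x \<bullet> x)\<^sup>2) *\<^sub>R x)"

definition hess_cosh_dist :: "real^'n::finite \<Rightarrow> real^'n \<Rightarrow> real^'n \<Rightarrow> real^'n" where
  "hess_cosh_dist Q x h = (4 / (1 - Q \<bullet> Q)) *\<^sub>R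
     ((1 / (1 - x \<bullet> x)) *\<^sub>R h + (2 * (x \<bullet> h) / (1 - x \<bullet> x)\<^sup>2) *\<^sub>R (x - Q)
      + (((x - Q) \<bullet> (x - Q)) / (1 - x \<bullet> x)\<^sup>2) *\<^sub>R h
      + (2 * ((x - Q) \<bullet> h) / (1 - x \<bullet> x)\<^sup>2
         + 4 * ((x - Q) \<bullet> (x - Q)) * (x \<bullet> h) / (1 - x \<bullet> x)^3) *\<^sub>R x)"

lemma in_hyp_space_iff: "x \<in> hyp_space \<longleftrightarrow> x \<bullet> x < 1"
  by (simp add: hyp_space_def norm_lt_square)

lemma hyp_dist_eq: "hyp_dist x Q = arcosh (cosh_dist Q x)"
  by (simp add: hyp_dist_def cosh_dist_def dot_square_norm)

lemma cosh_dist_ge_1: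
  assumes "x \<in> hyp_space" "Q \<in> hyp_space"
  shows "1 \<le> cosh_dist Q x"
  using assms by (simp add: cosh_dist_def in_hyp_space_iff)

lemma cosh_dist_gt_1:
  assumes "x \<in> hyp_space - {Q}" "Q \<in> hyp_space"
  shows "1 < cosh_dist Q x"
  using assms by (simp add: cosh_dist_def in_hyp_space_iff)

lemma cosh_dist_has_derivative:
  assumes "x \<in> hyp_space"
  shows "(cosh_dist Q has_derivative (\<lambda>h. grad_cosh_dist Q x \<bullet> h)) (at x)"
proof -
  define k s a where "k = 1 - Q \<bullet> Q" and "s = 1 - x \<bullet> x" and "a = (x - Q) \<bullet> (x - Q)"
  have s: "s \<noteq> 0" using assms by (simp add: in_hyp_space_iff s_def)
  have a': "((\<lambda>x. (x - Q) \<bullet> (x - Q)) has_derivative (\<lambda>h. 2 * ((x - Q) \<bullet> h))) (at x)"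
    by (rule derivative_eq_intros refl)+ (simp add: inner_commute fun_eq_iff)
  have s': "((\<lambda>x. 1 - x \<bullet> x) has_derivative (\<lambda>h. - 2 * (x \<bullet> h))) (at x)"
    by (rule derivative_eq_intros refl)+ (simp add: inner_commute fun_eq_iff)
  have "((\<lambda>x. ((x - Q) \<bullet> (x - Q)) / (1 - x \<bullet> x)) has_derivative
      (\<lambda>h. (2 * ((x - Q) \<bullet> h) * s - a * (- 2 * (x \<bullet> h))) / (s * s))) (at x)"
    unfolding s_def a_def
    by (rule has_derivative_divide'[OF a' s']) (use s in \<open>simp add: s_def\<close>)
  from has_derivative_add[OF has_derivative_const[of 1] has_derivative_mult_right[OF this, of "2 / k"]]
  have "((\<lambda>x. 1 + 2 / k * (((x - Q) \<bullet> (x - Q)) / (1 - x \<bullet> x))) has_derivative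
      (\<lambda>h. 2 / k * ((2 * ((x - Q) \<bullet> h) * s - a * (- 2 * (x \<bullet> h))) / (s * s)))) (at x)"
    by simp
  moreover have "(\<lambda>x. 1 + 2 / k * (((x - Q) \<bullet> (x - Q)) / (1 - x \<bullet> x))) = cosh_dist Q"
    by (simp add: cosh_dist_def fun_eq_iff k_def)
  moreover have "(\<lambda>h. 2 / k * ((2 * ((x - Q) \<bullet> h) * s - a * (- 2 * (x \<bullet> h))) / (s * s)))
      = (\<lambda>h. grad_cosh_dist Q x \<bullet> h)"
  proof
    fix h
    have "2 / k * ((2 * p * s - a * (- 2 * q)) / (s * s)) = 4 / k * (p / s + a / s\<^sup>2 * q)" for p q
      using s by (simp add: add_divide_distrib power2_eq_square algebra_simps)
    then show "2 / k * ((2 * ((x - Q) \<bullet> h) * s - a * (- 2 * (x \<bullet> h))) / (s * s))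
        = grad_cosh_dist Q x \<bullet> h"
      unfolding grad_cosh_dist_def k_def[symmetric] s_def[symmetric] a_def[symmetric]
      by (simp add: inner_add_left)
  qed
  ultimately show ?thesis by simp
qed

lemma grad_cosh_dist_has_derivative:
  assumes "x \<in> hyp_space"
  shows "(grad_cosh_dist Q has_derivative hess_cosh_dist Q x) (at x)"
proof -
  define k s a where "k = 1 - Q \<bullet> Q" and "s = 1 - x \<bullet> x" and "a = (x - Q) \<bullet> (x - Q)"
  have s: "s \<noteq> 0" using assms by (simp add: in_hyp_space_iff s_def)
  have a': "((\<lambda>x. (x - Q) \<bullet> (x - Q)) has_derivative (\<lambda>h. 2 * ((x - Q) \<bullet> h))) (at x)"
    by (rule derivative_eq_intros refl)+ (simp add: inner_commute fun_eq_iff)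
  have s': "((\<lambda>x. 1 - x \<bullet> x) has_derivative (\<lambda>h. - 2 * (x \<bullet> h))) (at x)"
    by (rule derivative_eq_intros refl)+ (simp add: inner_commute fun_eq_iff)
  have s2': "((\<lambda>x. (1 - x \<bullet> x)\<^sup>2) has_derivative (\<lambda>h. - 4 * s * (x \<bullet> h))) (at x)"
    using has_derivative_power[OF s', of 2] by (simp add: s_def algebra_simps)
  have 1: "((\<lambda>x. 1 / (1 - x \<bullet> x)) has_derivative (\<lambda>h. 2 * (x \<bullet> h) / s\<^sup>2)) (at x)"
    using has_derivative_divide'[OF has_derivative_const[of 1] s'] s
    by (simp add: s_def power2_eq_square)
  have "((\<lambda>x. ((x - Q) \<bullet> (x - Q)) / (1 - x \<bullet> x)\<^sup>2) has_derivative
      (\<lambda>h. (2 * ((x - Q) \<bullet> h) * s\<^sup>2 - a * (- 4 * s * (x \<bullet> h))) / (s\<^sup>2 * s\<^sup>2))) (at x)"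
    using has_derivative_divide'[OF a' s2'] s by (simp add: s_def a_def)
  moreover have "(2 * p * s\<^sup>2 - a * (- 4 * s * q)) / (s\<^sup>2 * s\<^sup>2) = 2 * p / s\<^sup>2 + 4 * a * q / s^3" for p q
    using s by (simp add: field_simps power2_eq_square power3_eq_cube)
  ultimately have 2: "((\<lambda>x. ((x - Q) \<bullet> (x - Q)) / (1 - x \<bullet> x)\<^sup>2) has_derivative
      (\<lambda>h. 2 * ((x - Q) \<bullet> h) / s\<^sup>2 + 4 * a * (x \<bullet> h) / s^3)) (at x)" by simp
  have id: "((\<lambda>x. x) has_derivative (\<lambda>h. h)) (at x)"
    "((\<lambda>x. x - Q) has_derivative (\<lambda>h. h)) (at x)" by (auto intro!: derivative_eq_intros)
  have "(grad_cosh_dist Q has_derivative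
     (\<lambda>h. (4 / k) *\<^sub>R ((1 / s) *\<^sub>R h + (2 * (x \<bullet> h) / s\<^sup>2) *\<^sub>R (x - Q)
        + ((a / s\<^sup>2) *\<^sub>R h + (2 * ((x - Q) \<bullet> h) / s\<^sup>2 + 4 * a * (x \<bullet> h) / s^3) *\<^sub>R x)))) (at x)"
    unfolding grad_cosh_dist_def[abs_def] k_def[symmetric]
    by (rule has_derivative_eq_rhs[OF has_derivative_scaleR_right[OF has_derivative_add[OF
          has_derivative_scaleR[OF 1 id(2)] has_derivative_scaleR[OF 2 id(1)]]]])
      (simp add: s_def a_def)
  moreover have "(\<lambda>h. (4 / k) *\<^sub>R ((1 / s) *\<^sub>R h + (2 * (x \<bullet> h) / s\<^sup>2) *\<^sub>R (x - Q)
        + ((a / s\<^sup>2) *\<^sub>R h + (2 * ((x - Q) \<bullet> h) / s\<^sup>2 + 4 * a * (x \<bullet> h) / s^3) *\<^sub>R x)))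
      = hess_cosh_dist Q x"
    by (simp add: hess_cosh_dist_def fun_eq_iff k_def s_def a_def add.assoc)
  ultimately show ?thesis by simp
qed

text \<open>
  This is \<open>\<bar>\<nabla> cosh r\<bar>\<^sup>2 = sinh\<^sup>2 r\<close>, the norm being hyperbolic: the conformal factor is
  \<open>2 / (1 - \<bar>x\<bar>\<^sup>2)\<close>.  All inner products reduce to \<open>a = \<bar>x - Q\<bar>\<^sup>2\<close>, \<open>s = 1 - \<bar>x\<bar>\<^sup>2\<close> and
  \<open>k = 1 - \<bar>Q\<bar>\<^sup>2\<close>, and the identity becomes one between rational functions of these.
\<close>

lemma grad_cosh_dist_norm:
  fixes x Q :: "real^'n::finite"
  assumes "x \<in> hyp_space" "Q \<in> hyp_space"
  shows "(grad_cosh_dist Q x \<bullet> grad_cosh_dist Q x) * ((1 - x \<bullet> x) / 2)\<^sup>2 = (cosh_dist Q x)\<^sup>2 - 1"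
proof -
  define k s a b where "k = 1 - Q \<bullet> Q" and "s = 1 - x \<bullet> x" and "a = (x - Q) \<bullet> (x - Q)"
    and "b = (x - Q) \<bullet> x"
  have s: "0 < s" and k: "0 < k" using assms by (simp_all add: in_hyp_space_iff s_def k_def)
  have b: "b = (a + k - s) / 2" and X: "x \<bullet> x = 1 - s"
    by (simp_all add: a_def b_def k_def s_def inner_diff_left inner_diff_right inner_commute field_simps)
  have gen: "(t *\<^sub>R (p *\<^sub>R y + q *\<^sub>R z)) \<bullet> (t *\<^sub>R (p *\<^sub>R y + q *\<^sub>R z))
      = t\<^sup>2 * (p\<^sup>2 * (y \<bullet> y) + 2 * (p * q) * (y \<bullet> z) + q\<^sup>2 * (z \<bullet> z))"
    for t p q and y z :: "real^'n"
    by (simp add: inner_add_left inner_add_right inner_commute power2_eq_square algebra_simps)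
  have "grad_cosh_dist Q x \<bullet> grad_cosh_dist Q x
      = (4 / k)\<^sup>2 * ((1 / s)\<^sup>2 * a + 2 * (1 / s * (a / s\<^sup>2)) * b + (a / s\<^sup>2)\<^sup>2 * (x \<bullet> x))"
    unfolding grad_cosh_dist_def k_def[symmetric] s_def[symmetric] a_def[symmetric]
    unfolding gen a_def[symmetric] b_def[symmetric] ..
  moreover have "(4 / k)\<^sup>2 * ((1 / s)\<^sup>2 * a + 2 * (1 / s * (a / s\<^sup>2)) * ((a + k - s) / 2) + (a / s\<^sup>2)\<^sup>2 * (1 - s)) * (s / 2)\<^sup>2
      = (1 + 2 * a / (s * k))\<^sup>2 - 1"
    using s k by (simp add: divide_simps) algebra
  ultimately show ?thesis
    unfolding cosh_dist_def b X unfolding k_def[symmetric] s_def[symmetric] a_def[symmetric] by simp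
qed

text \<open>
  This is \<open>\<Delta> cosh r = N cosh r\<close>, with the hyperbolic Laplacian written out in Euclidean terms as in
  \<open>hyp_laplacian_eq\<close>.  The reduction to \<open>a\<close>, \<open>s\<close> and \<open>k\<close> is the same.
\<close>

lemma hess_cosh_dist_trace:
  fixes x Q :: "real^'n::finite"
  assumes "x \<in> hyp_space" "Q \<in> hyp_space"
  shows "(real CARD('n) - 2) * (grad_cosh_dist Q x \<bullet> x) * ((1 - x \<bullet> x) / 2)
       + (\<Sum>i\<in>UNIV. hess_cosh_dist Q x (axis i 1) $ i) * ((1 - x \<bullet> x) / 2)\<^sup>2
     = real CARD('n) * cosh_dist Q x"
proof -
  define k s a b n where "k = 1 - Q \<bullet> Q" and "s = 1 - x \<bullet> x" and "a = (x - Q) \<bullet> (x - Q)"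
    and "b = (x - Q) \<bullet> x" and "n = real CARD('n)"
  have s: "0 < s" and k: "0 < k" using assms by (simp_all add: in_hyp_space_iff s_def k_def)
  have b: "b = (a + k - s) / 2" and X: "x \<bullet> x = 1 - s"
    by (simp_all add: a_def b_def k_def s_def inner_diff_left inner_diff_right inner_commute field_simps)
  have 1: "grad_cosh_dist Q x \<bullet> x = 4 / k * (b / s + a / s\<^sup>2 * (1 - s))"
    unfolding grad_cosh_dist_def k_def[symmetric] s_def[symmetric] a_def[symmetric]
    by (simp add: inner_add_left b_def X)
  have sums: "(\<Sum>i\<in>UNIV. x $ i * (x - Q) $ i) = b" "(\<Sum>i\<in>UNIV. (x - Q) $ i * x $ i) = b"
      "(\<Sum>i\<in>UNIV. x $ i * x $ i) = 1 - s"
    unfolding b_def X[symmetric] by (simp_all add: inner_vec_def mult.commute)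
  have "hess_cosh_dist Q x (axis i 1) $ i = 4 / k * (1 / s + 2 / s\<^sup>2 * (x $ i * (x - Q) $ i) + a / s\<^sup>2
      + (2 / s\<^sup>2 * ((x - Q) $ i * x $ i) + 4 * a / s^3 * (x $ i * x $ i)))" for i
    unfolding hess_cosh_dist_def k_def[symmetric] s_def[symmetric] a_def[symmetric]
    by (simp only: vector_add_component vector_scaleR_component inner_axis axis_nth real_scaleR_def
        inner_real_def) (simp add: algebra_simps del: vector_minus_component)
  then have "(\<Sum>i\<in>UNIV. hess_cosh_dist Q x (axis i 1) $ i)
      = 4 / k * (\<Sum>i\<in>(UNIV::'n set). 1 / s + 2 / s\<^sup>2 * (x $ i * (x - Q) $ i) + a / s\<^sup>2
      + (2 / s\<^sup>2 * ((x - Q) $ i * x $ i) + 4 * a / s^3 * (x $ i * x $ i)))"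
    by (simp add: sum_distrib_left)
  also have "\<dots> = 4 / k * (n / s + 2 / s\<^sup>2 * b + n * a / s\<^sup>2 + (2 / s\<^sup>2 * b + 4 * a / s^3 * (1 - s)))"
    unfolding sum.distrib sum_distrib_left[symmetric] sums by (simp add: n_def)
  finally have 2: "(\<Sum>i\<in>UNIV. hess_cosh_dist Q x (axis i 1) $ i) = \<dots>" .
  have "(n - 2) * (4 / k * (((a + k - s) / 2) / s + a / s\<^sup>2 * (1 - s))) * (s / 2)
     + 4 / k * (n / s + 2 / s\<^sup>2 * ((a + k - s) / 2) + n * a / s\<^sup>2
         + (2 / s\<^sup>2 * ((a + k - s) / 2) + 4 * a / s^3 * (1 - s))) * (s / 2)\<^sup>2
     = n * (1 + 2 * a / (s * k))"
    using s k by (simp add: divide_simps) algebra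
  then show ?thesis
    unfolding 1 2 unfolding b cosh_dist_def
    unfolding k_def[symmetric] s_def[symmetric] a_def[symmetric] n_def[symmetric] .
qed

section \<open>The Laplacian of radial functions\<close>

lemma sqrt_det_hyp_metric:
  fixes y :: "real^'n::finite"
  assumes "y \<in> hyp_space"
  shows "sqrt (det (hyp_metric y)) = (2 / (1 - y \<bullet> y)) ^ CARD('n)"
proof -
  have pos: "0 < 2 / (1 - y \<bullet> y)" using assms by (simp add: in_hyp_space_iff)
  have "det (hyp_metric y) = (\<Prod>i\<in>(UNIV :: 'n set). (2 / (1 - y \<bullet> y))\<^sup>2)"
    by (subst det_diagonal) (simp_all add: hyp_metric_def mat_def dot_square_norm)
  also have "\<dots> = ((2 / (1 - y \<bullet> y)) ^ CARD('n))\<^sup>2"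
    by (simp flip: power_mult add: mult.commute)
  finally show ?thesis using pos by (simp del: power_divide add: real_sqrt_abs)
qed

lemma matrix_inv_mat:
  fixes k :: real
  assumes "k \<noteq> 0"
  shows "matrix_inv (mat k :: real^'n^'n::finite) = mat (1 / k)"
proof -
  have m: "mat a ** mat b = (mat (a * b) :: real^'n^'n)" for a b :: real
  proof -
    have "(\<Sum>l\<in>UNIV. (if i = l then a else 0) * (if l = j then b else 0)) = (if i = j then a * b else 0)"
      for i j :: 'n
    proof -
      have "(\<Sum>l\<in>UNIV. (if i = l then a else 0) * (if l = j then b else 0))
          = (\<Sum>l\<in>UNIV. if l = i then a * (if l = j then b else 0) else 0)"
        by (rule sum.cong) auto
      then show ?thesis by simp
    qed
    then show ?thesis by (simp add: matrix_matrix_mult_def mat_def vec_eq_iff)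
  qed
  show ?thesis unfolding matrix_inv_def
  proof (rule some_equality)
    show "mat k ** mat (1 / k) = (mat 1 :: real^'n^'n) \<and> mat (1 / k) ** mat k = (mat 1 :: real^'n^'n)"
      using assms by (simp add: m)
    fix B :: "real^'n^'n" assume B: "mat k ** B = mat 1 \<and> B ** mat k = mat 1"
    have "B = (mat (1 / k) ** mat k) ** B" using assms by (simp add: m)
    also have "\<dots> = mat (1 / k)" using B by (simp flip: matrix_mul_assoc)
    finally show "B = mat (1 / k)" .
  qed
qed

lemma partial_deriv_eqI:
  assumes "(f has_derivative D) (at x)"
  shows "partial_deriv i f x = D (axis i 1)"
  unfolding partial_deriv_def using frechet_derivative_at[OF assms] by simp

text \<open>
  With the conformal factor \<open>\<rho> = 2 / (1 - \<bar>x\<bar>\<^sup>2)\<close> the Laplacian is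
  \<open>\<rho>\<^sup>-\<^sup>N div (\<rho>\<^sup>N\<^sup>-\<^sup>2 \<nabla>u)\<close>, and the gradient of \<open>\<rho>\<close> is \<open>\<rho>\<^sup>2 x\<close>.
\<close>

lemma hyp_laplacian_eq:
  fixes x :: "real^'n::finite"
  assumes n: "2 \<le> CARD('n)" and S: "open S" "S \<subseteq> hyp_space" "x \<in> S"
    and u: "\<And>y. y \<in> S \<Longrightarrow> (u has_derivative (\<lambda>h. G y \<bullet> h)) (at y)"
    and G: "(G has_derivative H) (at x)"
  shows "hyp_laplacian u x = (real CARD('n) - 2) * (G x \<bullet> x) * ((1 - x \<bullet> x) / 2)
       + (\<Sum>i\<in>UNIV. H (axis i 1) $ i) * ((1 - x \<bullet> x) / 2)\<^sup>2"
proof -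
  \<comment> \<open>The exponent \<open>N - 2\<close> of the conformal factor becomes a natural number \<open>m\<close>.\<close>
  obtain m where m: "CARD('n) = m + 2" using n by (metis le_iff_add add.commute)
  define \<rho> where "\<rho> = (\<lambda>y :: real^'n. 2 / (1 - y \<bullet> y))"
  have s: "1 - y \<bullet> y \<noteq> 0" if "y \<in> S" for y using that S by (auto simp: in_hyp_space_iff)
  have \<rho>0: "\<rho> y \<noteq> 0" if "y \<in> S" for y using s[OF that] by (simp add: \<rho>_def)
  have inner: "sqrt (det (hyp_metric y)) * (\<Sum>j\<in>UNIV. matrix_inv (hyp_metric y) $ i $ j * partial_deriv j u y)
      = \<rho> y ^ m * G y $ i" if y: "y \<in> S" for y and i :: 'n
  proof -
    have "matrix_inv (hyp_metric y) = mat (1 / (\<rho> y)\<^sup>2)"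
      unfolding hyp_metric_def \<rho>_def using s[OF y]
      by (subst matrix_inv_mat) (simp_all add: dot_square_norm)
    moreover have "partial_deriv j u y = G y $ j" for j
      using partial_deriv_eqI[OF u[OF y], of j] by (simp add: inner_axis)
    ultimately have "(\<Sum>j\<in>UNIV. matrix_inv (hyp_metric y) $ i $ j * partial_deriv j u y)
        = 1 / (\<rho> y)\<^sup>2 * G y $ i"
      by (simp add: mat_def if_distrib if_distribR cong: if_cong)
    moreover have "sqrt (det (hyp_metric y)) = \<rho> y ^ m * (\<rho> y)\<^sup>2"
      using sqrt_det_hyp_metric[of y] subsetD[OF S(2) y] by (simp only: \<rho>_def m power_add)
    ultimately show ?thesis using \<rho>0[OF y] by simp
  qed
  have D\<rho>: "(\<rho> has_derivative (\<lambda>h. (\<rho> x)\<^sup>2 * (x \<bullet> h))) (at x)"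
  proof -
    have s': "((\<lambda>x. 1 - x \<bullet> x) has_derivative (\<lambda>h. - 2 * (x \<bullet> h))) (at x)"
      by (rule derivative_eq_intros refl)+ (simp add: inner_commute fun_eq_iff)
    show ?thesis
      using has_derivative_divide'[OF has_derivative_const[of 2] s' s[OF S(3)]]
      by (simp add: \<rho>_def[abs_def] power2_eq_square)
  qed
  have D\<rho>m: "((\<lambda>y. \<rho> y ^ m) has_derivative (\<lambda>h. real m * \<rho> x ^ (m + 1) * (x \<bullet> h))) (at x)"
    by (rule has_derivative_eq_rhs[OF has_derivative_power[OF D\<rho>]])
      (cases m; simp add: fun_eq_iff power2_eq_square mult_ac)
  have outer: "partial_deriv i (\<lambda>y. sqrt (det (hyp_metric y)) *
        (\<Sum>j\<in>UNIV. matrix_inv (hyp_metric y) $ i $ j * partial_deriv j u y)) x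
      = real m * \<rho> x ^ (m + 1) * (G x $ i * x $ i) + \<rho> x ^ m * H (axis i 1) $ i" for i :: 'n
  proof -
    have "((\<lambda>y. G y $ i) has_derivative (\<lambda>h. H h $ i)) (at x)"
      by (rule bounded_linear.has_derivative[OF bounded_linear_vec_nth G])
    from has_derivative_mult[OF D\<rho>m this]
    have "((\<lambda>y. \<rho> y ^ m * G y $ i) has_derivative
        (\<lambda>h. \<rho> x ^ m * H h $ i + real m * \<rho> x ^ (m + 1) * (x \<bullet> h) * G x $ i)) (at x)" .
    from has_derivative_transform_within_open[OF this S(1,3)]
    have "((\<lambda>y. sqrt (det (hyp_metric y)) *
        (\<Sum>j\<in>UNIV. matrix_inv (hyp_metric y) $ i $ j * partial_deriv j u y)) has_derivative
        (\<lambda>h. \<rho> x ^ m * H h $ i + real m * \<rho> x ^ (m + 1) * (x \<bullet> h) * G x $ i)) (at x)"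
      using inner by simp
    from partial_deriv_eqI[OF this] show ?thesis by (simp add: inner_axis)
  qed
  have "(\<Sum>i\<in>UNIV. real m * \<rho> x ^ (m + 1) * (G x $ i * x $ i) + \<rho> x ^ m * H (axis i 1) $ i)
      = real m * \<rho> x ^ (m + 1) * (G x \<bullet> x) + \<rho> x ^ m * (\<Sum>i\<in>UNIV. H (axis i 1) $ i)"
    by (simp add: sum.distrib inner_vec_def sum_distrib_left)
  moreover have "sqrt (det (hyp_metric x)) = \<rho> x ^ (m + 2)"
    using sqrt_det_hyp_metric[OF subsetD[OF S(2,3)]] by (simp only: \<rho>_def m)
  ultimately have "hyp_laplacian u x = 1 / \<rho> x ^ (m + 2)
      * (real m * \<rho> x ^ (m + 1) * (G x \<bullet> x) + \<rho> x ^ m * (\<Sum>i\<in>UNIV. H (axis i 1) $ i))"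
    unfolding hyp_laplacian_def laplace_beltrami_def outer by simp
  also have "\<dots> = real m * (G x \<bullet> x) * (1 / \<rho> x) + (\<Sum>i\<in>UNIV. H (axis i 1) $ i) * (1 / \<rho> x)\<^sup>2"
  proof -
    have frac: "1 / R ^ (m + 2) * (k * R ^ (m + 1) * g + R ^ m * t) = k * g * (1 / R) + t * (1 / R)\<^sup>2"
      if "R \<noteq> 0" for R k g t :: real
      using that by (simp add: power_add power2_eq_square distrib_left)
    show ?thesis by (rule frac[OF \<rho>0[OF S(3)]])
  qed
  also have "1 / \<rho> x = (1 - x \<bullet> x) / 2" by (simp add: \<rho>_def)
  also have "real m = real CARD('n) - 2" by (simp add: m)
  finally show ?thesis .
qed

lemma radial_gradient:
  fixes Q x :: "real^'n::finite"
  assumes x: "x \<in> hyp_space"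
    and F: "(F has_real_derivative F1 (cosh_dist Q x)) (at (cosh_dist Q x))"
  shows "((\<lambda>y. F (cosh_dist Q y)) has_derivative
    (\<lambda>h. (F1 (cosh_dist Q x) *\<^sub>R grad_cosh_dist Q x) \<bullet> h)) (at x)"
proof -
  have "(F has_derivative (\<lambda>t. t * F1 (cosh_dist Q x))) (at (cosh_dist Q x))"
    using F by (simp add: has_field_derivative_def mult_commute_abs)
  from has_derivative_compose[OF cosh_dist_has_derivative[OF x] this]
  show ?thesis by (simp add: mult.commute)
qed

lemma radial_hessian:
  fixes Q x :: "real^'n::finite"
  assumes x: "x \<in> hyp_space"
    and F: "(F1 has_real_derivative F2) (at (cosh_dist Q x))"
  shows "((\<lambda>y. F1 (cosh_dist Q y) *\<^sub>R grad_cosh_dist Q y) has_derivative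
    (\<lambda>h. F1 (cosh_dist Q x) *\<^sub>R hess_cosh_dist Q x h
      + (F2 * (grad_cosh_dist Q x \<bullet> h)) *\<^sub>R grad_cosh_dist Q x)) (at x)"
proof -
  have "((\<lambda>y. F1 (cosh_dist Q y)) has_derivative (\<lambda>h. F2 * (grad_cosh_dist Q x \<bullet> h))) (at x)"
    using radial_gradient[OF x, of F1 "\<lambda>_. F2" Q] F by simp
  from has_derivative_scaleR[OF this grad_cosh_dist_has_derivative[OF x]]
  show ?thesis .
qed

lemma hyp_laplacian_radial:
  fixes x Q :: "real^'n::finite"
  assumes n: "2 \<le> CARD('n)" and S: "open S" "S \<subseteq> hyp_space" "x \<in> S" and Q: "Q \<in> hyp_space"
    and u: "\<And>y. y \<in> S \<Longrightarrow> u y = F (cosh_dist Q y)"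
    and F: "\<And>y. y \<in> S \<Longrightarrow> (F has_real_derivative F1 (cosh_dist Q y)) (at (cosh_dist Q y))"
    and F1: "(F1 has_real_derivative F2) (at (cosh_dist Q x))"
  shows "hyp_laplacian u x = ((cosh_dist Q x)\<^sup>2 - 1) * F2 + real CARD('n) * cosh_dist Q x * F1 (cosh_dist Q x)"
proof -
  have x: "x \<in> hyp_space" using S by blast
  define g T where "g = grad_cosh_dist Q x" and "T = (\<Sum>i\<in>UNIV. hess_cosh_dist Q x (axis i 1) $ i)"
  define f1 q where "f1 = F1 (cosh_dist Q x)" and "q = (1 - x \<bullet> x) / 2"
  have Du: "(u has_derivative (\<lambda>h. (F1 (cosh_dist Q y) *\<^sub>R grad_cosh_dist Q y) \<bullet> h)) (at y)"
    if y: "y \<in> S" for y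
  proof (rule has_derivative_transform_within_open[OF _ S(1) y])
    show "((\<lambda>z. F (cosh_dist Q z)) has_derivative
        (\<lambda>h. (F1 (cosh_dist Q y) *\<^sub>R grad_cosh_dist Q y) \<bullet> h)) (at y)"
      using radial_gradient[where ?F1.0 = F1 and F = F, OF subsetD[OF S(2) y] F[OF y]] .
  qed (simp add: u)
  have DG: "((\<lambda>y. F1 (cosh_dist Q y) *\<^sub>R grad_cosh_dist Q y) has_derivative
    (\<lambda>h. F1 (cosh_dist Q x) *\<^sub>R hess_cosh_dist Q x h
      + (F2 * (grad_cosh_dist Q x \<bullet> h)) *\<^sub>R grad_cosh_dist Q x)) (at x)"
    using radial_hessian[where ?F1.0 = F1, OF x F1] .
  from hyp_laplacian_eq[OF n S Du DG]
  have "hyp_laplacian u x = (real CARD('n) - 2) * ((f1 *\<^sub>R g) \<bullet> x) * q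
      + (\<Sum>i\<in>UNIV. (f1 *\<^sub>R hess_cosh_dist Q x (axis i 1) + (F2 * (g \<bullet> axis i 1)) *\<^sub>R g) $ i) * q\<^sup>2"
    unfolding g_def f1_def q_def .
  also have "(\<Sum>i\<in>UNIV. (f1 *\<^sub>R hess_cosh_dist Q x (axis i 1) + (F2 * (g \<bullet> axis i 1)) *\<^sub>R g) $ i)
      = (\<Sum>i\<in>UNIV. f1 * hess_cosh_dist Q x (axis i 1) $ i + F2 * (g $ i * g $ i))"
    by (rule sum.cong) (simp_all add: inner_axis)
  also have "\<dots> = f1 * T + F2 * (g \<bullet> g)"
    unfolding T_def inner_vec_def sum.distrib sum_distrib_left by simp
  also have "(real CARD('n) - 2) * ((f1 *\<^sub>R g) \<bullet> x) * q + (f1 * T + F2 * (g \<bullet> g)) * q\<^sup>2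
      = F2 * ((g \<bullet> g) * q\<^sup>2) + f1 * ((real CARD('n) - 2) * (g \<bullet> x) * q + T * q\<^sup>2)"
    by (simp add: algebra_simps)
  also have "(g \<bullet> g) * q\<^sup>2 = (cosh_dist Q x)\<^sup>2 - 1"
    unfolding g_def q_def by (rule grad_cosh_dist_norm[OF x Q])
  also have "(real CARD('n) - 2) * (g \<bullet> x) * q + T * q\<^sup>2 = real CARD('n) * cosh_dist Q x"
    unfolding g_def q_def T_def by (rule hess_cosh_dist_trace[OF x Q])
  finally show ?thesis by (simp add: f1_def mult_ac)
qed

text \<open>
  In finite dimension continuity of the second derivative in the operator norm can be tested on the
  vectors of a basis.
\<close>

lemma C2_on_radial:
  fixes Q :: "real^'n::finite"
  assumes Q: "Q \<in> hyp_space"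
    and F: "\<And>y. 1 \<le> y \<Longrightarrow> (F has_real_derivative F1 y) (at y)"
    and F1: "\<And>y. 1 \<le> y \<Longrightarrow> (F1 has_real_derivative F2 y) (at y)"
    and F2: "continuous_on {1..} F2"
  shows "C2_on hyp_space (\<lambda>x :: real^'n. F (cosh_dist Q x))"
proof -
  let ?G = "\<lambda>x. F1 (cosh_dist Q x) *\<^sub>R grad_cosh_dist Q x"
  let ?H = "\<lambda>x h. F1 (cosh_dist Q x) *\<^sub>R hess_cosh_dist Q x h
      + (F2 (cosh_dist Q x) * (grad_cosh_dist Q x \<bullet> h)) *\<^sub>R grad_cosh_dist Q x"
  note ge = cosh_dist_ge_1[OF _ Q]
  have G: "((\<lambda>y. F (cosh_dist Q y)) has_derivative (\<lambda>h. ?G x \<bullet> h)) (at x)" if "x \<in> hyp_space" for x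
    using radial_gradient[where ?F1.0 = F1 and F = F, OF that F[OF ge[OF that]]] .
  have H: "(?G has_derivative ?H x) (at x)" if "x \<in> hyp_space" for x
    using radial_hessian[where ?F1.0 = F1, OF that F1[OF ge[OF that]]] .
  \<comment> \<open>Riesz representation turns the gradient field into the derivative.\<close>
  define f' where "f' = (\<lambda>x. blinfun_inner_left (?G x))"
  define f'' where "f'' = (\<lambda>x. Blinfun (\<lambda>h. blinfun_inner_left (?H x h)))"
  have f'': "blinfun_apply (f'' x) = (\<lambda>h. blinfun_inner_left (?H x h))" if "x \<in> hyp_space" for x
    unfolding f''_def
    by (intro bounded_linear_Blinfun_apply bounded_linear_compose[OF bounded_linear_blinfun_inner_left]
        has_derivative_bounded_linear[OF H[OF that]])
  have "\<forall>x\<in>hyp_space. ((\<lambda>x. F (cosh_dist Q x)) has_derivative blinfun_apply (f' x)) (at x)"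
    using G by (simp add: f'_def inner_commute)
  moreover have "\<forall>x\<in>hyp_space. (f' has_derivative blinfun_apply (f'' x)) (at x)"
    using bounded_linear.has_derivative[OF bounded_linear_blinfun_inner_left H] f''
    by (simp add: f'_def)
  moreover have "continuous_on hyp_space f''"
  proof (rule continuous_on_blinfun_componentwise)
    fix i :: "real^'n"
    have dist: "continuous_on hyp_space (cosh_dist Q)"
      using cosh_dist_has_derivative
      by (intro continuous_at_imp_continuous_on ballI) (rule has_derivative_continuous)
    have F1c: "continuous_on {1..} F1"
      using F1 by (meson DERIV_isCont continuous_at_imp_continuous_on atLeast_iff)
    have grad: "continuous_on hyp_space (grad_cosh_dist Q)"
      using grad_cosh_dist_has_derivative
      by (intro continuous_at_imp_continuous_on ballI) (rule has_derivative_continuous)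
    have nz: "1 - x \<bullet> x \<noteq> 0" if "x \<in> hyp_space" for x :: "real^'n"
      using that by (simp add: in_hyp_space_iff)
    have hess: "continuous_on hyp_space (\<lambda>x. hess_cosh_dist Q x i)"
      unfolding hess_cosh_dist_def by (intro continuous_intros) (use nz in auto)
    have im: "cosh_dist Q ` hyp_space \<subseteq> {1..}" using ge by auto
    have "continuous_on hyp_space (\<lambda>x. blinfun_inner_left (?H x i))"
      by (intro bounded_linear.continuous_on[OF bounded_linear_blinfun_inner_left] continuous_intros
          hess grad continuous_on_compose2[OF F1c dist im] continuous_on_compose2[OF F2 dist im])
    then show "continuous_on hyp_space (\<lambda>x. blinfun_apply (f'' x) i)"
      by (rule continuous_on_eq) (simp add: f'')
  qed
  ultimately show ?thesis unfolding C2_on_def by blast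
qed

section \<open>The profile of a radial function\<close>

text \<open>
  On the ray from \<open>Q\<close> in a unit direction orthogonal to \<open>Q\<close>, the point with \<open>cosh_dist\<close> equal to \<open>y\<close>
  has this Euclidean distance from \<open>Q\<close>, where \<open>k = 1 - \<bar>Q\<bar>\<^sup>2\<close>.  Orthogonality is what makes
  \<open>cosh_dist\<close> explicitly invertible along the ray.
\<close>

definition ray_param :: "real \<Rightarrow> real \<Rightarrow> real" where
  "ray_param k y = k * sqrt ((y - 1) / (2 + (y - 1) * k))"

lemma ray_param_sq:
  assumes "0 < k" "1 < y"
  shows "(ray_param k y)\<^sup>2 = k\<^sup>2 * (y - 1) / (2 + (y - 1) * k)"
proof -
  have "0 \<le> (y - 1) / (2 + (y - 1) * k)" using assms by simp
  then show ?thesis by (simp add: ray_param_def power_mult_distrib)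
qed

lemma ray_param_deriv:
  assumes k: "0 < k"
  obtains t1 t2 where
    "\<And>y. 1 < y \<Longrightarrow> (ray_param k has_real_derivative t1 y) (at y)"
    "\<And>y. 1 < y \<Longrightarrow> (t1 has_real_derivative t2 y) (at y)"
proof -
  let ?d = "\<lambda>y. 2 + (y - 1) * k"
  define t1 where "t1 = (\<lambda>y. k * (2 / (?d y)\<^sup>2 * (inverse (sqrt ((y - 1) / ?d y)) / 2)))"
  have d: "0 < ?d y" if "1 < y" for y using that k by (simp add: add_pos_pos)
  have R: "((\<lambda>y. (y - 1) / ?d y) has_real_derivative 2 / (?d y)\<^sup>2) (at y)" if "1 < y" for y
  proof -
    have "((\<lambda>y. (y - 1) / ?d y) has_real_derivative (1 * ?d y - (y - 1) * k) / (?d y * ?d y)) (at y)"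
      by (rule DERIV_divide) (use d[OF that] in \<open>auto intro!: derivative_eq_intros\<close>)
    then show ?thesis by (simp add: power2_eq_square)
  qed
  have Rpos: "0 < (y - 1) / ?d y" if "1 < y" for y using d[OF that] that by simp
  have S: "((\<lambda>y. sqrt ((y - 1) / ?d y)) has_real_derivative
      inverse (sqrt ((y - 1) / ?d y)) / 2 * (2 / (?d y)\<^sup>2)) (at y)" if "1 < y" for y
    by (rule DERIV_chain2[OF DERIV_real_sqrt[OF Rpos[OF that]] R[OF that]])
  have "(ray_param k has_real_derivative t1 y) (at y)" if "1 < y" for y
    unfolding ray_param_def[abs_def] t1_def using DERIV_cmult[OF S[OF that], of k] by (simp add: mult_ac)
  moreover have "\<exists>t2. (t1 has_real_derivative t2) (at y)" if "1 < y" for y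
  proof -
    have "t1 differentiable (at y)"
      unfolding t1_def
      using d[OF that] Rpos[OF that] S[OF that]
      by (intro derivative_intros) (auto simp: real_differentiable_def)
    then show ?thesis by (simp add: real_differentiable_def)
  qed
  then obtain t2 where "\<And>y. 1 < y \<Longrightarrow> (t1 has_real_derivative t2 y) (at y)" by metis
  ultimately show ?thesis using that by blast
qed

lemma orthogonal_unit_exists:
  fixes Q :: "real^'n::finite"
  assumes "2 \<le> CARD('n)"
  obtains e :: "real^'n" where "e \<bullet> e = 1" "Q \<bullet> e = 0"
proof -
  obtain y :: "real^'n" where y: "y \<noteq> 0" "orthogonal Q y"
    using orthogonal_to_vector_exists[of Q] assms by auto
  show ?thesis
    by (rule that[of "y /\<^sub>R norm y"]) (use y in \<open>auto simp: orthogonal_def dot_square_norm power2_eq_square\<close>)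
qed

lemma cosh_dist_ray:
  fixes Q e :: "real^'n::finite"
  assumes Q: "Q \<in> hyp_space" and e: "e \<bullet> e = 1" "Q \<bullet> e = 0" and y: "1 < y"
  defines "x \<equiv> Q + ray_param (1 - Q \<bullet> Q) y *\<^sub>R e"
  shows "x \<in> hyp_space - {Q}" "cosh_dist Q x = y"
proof -
  define k t where "k = 1 - Q \<bullet> Q" and "t = ray_param k y"
  have k: "0 < k" using Q by (simp add: in_hyp_space_iff k_def)
  have d: "0 < 2 + (y - 1) * k" using y k by (simp add: add_pos_pos)
  have t2: "t\<^sup>2 = k\<^sup>2 * (y - 1) / (2 + (y - 1) * k)" unfolding t_def by (rule ray_param_sq[OF k y])
  have "t \<noteq> 0" using y k d by (simp add: t_def ray_param_def)
  moreover have "e \<noteq> 0" using e by auto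
  ultimately have "x \<noteq> Q" by (simp add: x_def t_def k_def)
  have xx: "1 - x \<bullet> x = k - t\<^sup>2"
    using e by (simp add: x_def t_def k_def inner_add_left inner_add_right inner_commute[of e Q] power2_eq_square)
  have kt: "k - t\<^sup>2 = 2 * k / (2 + (y - 1) * k)"
    unfolding t2 using d by (simp add: field_simps power2_eq_square)
  then have "0 < 1 - x \<bullet> x" unfolding xx using k d by simp
  with \<open>x \<noteq> Q\<close> show "x \<in> hyp_space - {Q}" by (simp add: in_hyp_space_iff)
  have "(x - Q) \<bullet> (x - Q) = t\<^sup>2" using e by (simp add: x_def t_def k_def power2_eq_square)
  then have "cosh_dist Q x = 1 + 2 * t\<^sup>2 / ((k - t\<^sup>2) * k)"
    by (simp add: cosh_dist_def xx k_def)
  also have "\<dots> = 1 + 2 * (k\<^sup>2 * (y - 1) / (2 + (y - 1) * k)) / (2 * k / (2 + (y - 1) * k) * k)"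
    unfolding kt unfolding t2 ..
  also have "\<dots> = y" using k d by (simp add: power2_eq_square)
  finally show "cosh_dist Q x = y" .
qed

lemma C2_on_along_curve:
  fixes u :: "real^'n::finite \<Rightarrow> real"
  assumes u: "C2_on S u" and S: "\<And>y. 1 < y \<Longrightarrow> q + t y *\<^sub>R e \<in> S"
    and t1: "\<And>y. 1 < y \<Longrightarrow> (t has_real_derivative t1 y) (at y)"
    and t2: "\<And>y. 1 < y \<Longrightarrow> (t1 has_real_derivative t2 y) (at y)"
  obtains F1 F2 where
    "\<And>y. 1 < y \<Longrightarrow> ((\<lambda>y. u (q + t y *\<^sub>R e)) has_real_derivative F1 y) (at y)"
    "\<And>y. 1 < y \<Longrightarrow> (F1 has_real_derivative F2 y) (at y)"
proof -
  obtain f' f'' where D: "\<And>x. x \<in> S \<Longrightarrow> (u has_derivative blinfun_apply (f' x)) (at x)"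
    "\<And>x. x \<in> S \<Longrightarrow> (f' has_derivative blinfun_apply (f'' x)) (at x)"
    using u unfolding C2_on_def by blast
  let ?g = "\<lambda>y. q + t y *\<^sub>R e"
  have g: "(?g has_derivative (\<lambda>h. (h * t1 y) *\<^sub>R e)) (at y)" if "1 < y" for y
  proof -
    have "(t has_derivative (\<lambda>h. h * t1 y)) (at y)"
      using t1[OF that] by (simp add: has_field_derivative_def mult_commute_abs)
    from has_derivative_add[OF has_derivative_const has_derivative_scaleR_left[OF this]]
    show ?thesis by simp
  qed
  define A where "A = (\<lambda>y. blinfun_apply (f' (?g y)) e)"
  define B where "B = (\<lambda>y. blinfun_apply (blinfun_apply (f'' (?g y)) e) e)"
  have F: "((\<lambda>y. u (?g y)) has_real_derivative t1 y * A y) (at y)" if "1 < y" for y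
    by (rule has_derivative_imp_has_field_derivative[OF has_derivative_compose[OF g[OF that] D(1)[OF S[OF that]]]])
      (simp add: A_def blinfun.scaleR_right)
  have A: "(A has_real_derivative t1 y * B y) (at y)" if "1 < y" for y
    unfolding A_def
    by (rule has_derivative_imp_has_field_derivative[OF bounded_linear.has_derivative[OF
          blinfun.bounded_linear_left has_derivative_compose[OF g[OF that] D(2)[OF S[OF that]]]]])
      (simp add: B_def blinfun.scaleR_right blinfun.scaleR_left)
  have prod: "((\<lambda>y. t1 y * A y) has_real_derivative t2 y * A y + (t1 y * B y) * t1 y) (at y)" if "1 < y" for y
    by (rule DERIV_mult[OF t2[OF that] A[OF that]])
  show ?thesis
    using that[of "\<lambda>y. t1 y * A y" "\<lambda>y. t2 y * A y + t1 y * B y * t1 y"] F prod by blast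
qed

text \<open>
  Restricting \<open>u\<close> to a ray from \<open>Q\<close> shows that its profile, as a function of \<open>cosh r\<close>, is twice
  differentiable.
\<close>

lemma radial_profile_exists:
  fixes u :: "real^'n::finite \<Rightarrow> real"
  assumes n: "2 \<le> CARD('n)" and Q: "Q \<in> hyp_space"
    and u: "C2_on (hyp_space - {Q}) u" and rad: "radial_about Q u"
  obtains F F1 F2 where
    "\<And>x. x \<in> hyp_space - {Q} \<Longrightarrow> u x = F (cosh_dist Q x)"
    "\<And>y. 1 < y \<Longrightarrow> (F has_real_derivative F1 y) (at y)"
    "\<And>y. 1 < y \<Longrightarrow> (F1 has_real_derivative F2 y) (at y)"
    "\<And>y. 1 < y \<Longrightarrow> \<exists>x\<in>hyp_space - {Q}. cosh_dist Q x = y"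
proof -
  obtain e :: "real^'n" where e: "e \<bullet> e = 1" "Q \<bullet> e = 0" by (rule orthogonal_unit_exists[OF n])
  have k: "0 < 1 - Q \<bullet> Q" using Q by (simp add: in_hyp_space_iff)
  let ?g = "\<lambda>y. Q + ray_param (1 - Q \<bullet> Q) y *\<^sub>R e"
  note ray = cosh_dist_ray[OF Q e]
  obtain t1 t2 where t: "\<And>y. 1 < y \<Longrightarrow> (ray_param (1 - Q \<bullet> Q) has_real_derivative t1 y) (at y)"
    "\<And>y. 1 < y \<Longrightarrow> (t1 has_real_derivative t2 y) (at y)"
    using ray_param_deriv[OF k] by blast
  obtain F1 F2 where F: "\<And>y. 1 < y \<Longrightarrow> ((\<lambda>y. u (?g y)) has_real_derivative F1 y) (at y)"
    "\<And>y. 1 < y \<Longrightarrow> (F1 has_real_derivative F2 y) (at y)"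
    by (rule C2_on_along_curve[OF u, of Q "ray_param (1 - Q \<bullet> Q)" e t1 t2])
      (use ray(1) t in \<open>blast+\<close>)
  have "u x = u (?g (cosh_dist Q x))" if x: "x \<in> hyp_space - {Q}" for x
  proof -
    note y = cosh_dist_gt_1[OF x Q]
    have "hyp_dist x Q = hyp_dist (?g (cosh_dist Q x)) Q"
      unfolding hyp_dist_eq ray(2)[OF y] ..
    then show ?thesis using rad x ray(1)[OF y] unfolding radial_about_def by blast
  qed
  then show ?thesis using that[OF _ F] ray by blast
qed

section \<open>Classification of the singular solutions\<close>

lemma cylinder_coordinate:
  fixes r :: real
  assumes "0 < r"
  shows "ln (tanh (r / 2)) < 0" "sinh (- ln (tanh (r / 2))) = 1 / sinh r"
    "cosh (ln (tanh (r / 2))) = cosh r / sinh r"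
proof -
  define S C where "S = sinh (r / 2)" and "C = cosh (r / 2)"
  have S: "0 < S" and C: "0 < C" using assms by (simp_all add: S_def C_def)
  have t: "tanh (r / 2) = S / C" by (simp add: tanh_def S_def C_def)
  have t0: "0 < S / C" using S C by simp
  have C2: "C\<^sup>2 = S\<^sup>2 + 1" by (simp add: C_def S_def cosh_square_eq)
  have r: "sinh r = 2 * S * C" "cosh r = C\<^sup>2 + S\<^sup>2"
    using sinh_double[of "r / 2"] cosh_double[of "r / 2"] by (simp_all add: S_def C_def)
  have "tanh (r / 2) < 1" by (rule tanh_real_lt_1)
  then show "ln (tanh (r / 2)) < 0" using t0 unfolding t by (simp del: divide_less_eq_1_pos)
  show "sinh (- ln (tanh (r / 2))) = 1 / sinh r"
    unfolding sinh_minus t sinh_ln_real[OF t0] r using S C C2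
    by (simp add: field_simps power2_eq_square)
  show "cosh (ln (tanh (r / 2))) = cosh r / sinh r"
    unfolding t cosh_ln_real[OF t0] r using S C
    by (simp add: field_simps power2_eq_square)
qed

text \<open>
  These are the solutions belonging to the zero energy level, written as
  \<open>F(cosh r)\<close> with \<open>F\<close> a power of an affine function \<open>L\<close>.  They are defined on the whole space, \<open>Q\<close>
  included, because \<open>L(1) = 2 \<beta> > 0\<close>.  The normalization of \<open>\<alpha> \<beta>\<close> enters as the
  difference of the squares of the coefficients of \<open>L\<close>, which is \<open>4 \<alpha> \<beta>\<close>.
\<close>

lemma homoclinic_hyp_solution:
  fixes Q :: "real^'n::finite"
  assumes N: "real CARD('n) = 2 * c + 2" and c: "0 < c" and Q: "Q \<in> hyp_space"
    and ab: "0 < \<alpha>" "0 < \<beta>" "4 * \<alpha> * \<beta> = 1 / (c * (c + 1))"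
  shows "hyp_solution_on (c * (c + 1)) (1 + 2 / c) hyp_space
    (\<lambda>x :: real^'n. ((\<alpha> + \<beta>) * cosh_dist Q x + (\<beta> - \<alpha>)) powr (- c))"
proof -
  define L where "L = (\<lambda>y. (\<alpha> + \<beta>) * y + (\<beta> - \<alpha>))"
  define F where "F = (\<lambda>y. L y powr (- c))"
  define F1 where "F1 = (\<lambda>y. - c * (\<alpha> + \<beta>) * L y powr (- c - 1))"
  define F2 where "F2 = (\<lambda>y. c * (c + 1) * (\<alpha> + \<beta>)\<^sup>2 * L y powr (- c - 2))"
  have Lpos: "0 < L y" if "1 \<le> y" for y
  proof -
    have "(\<alpha> + \<beta>) * 1 \<le> (\<alpha> + \<beta>) * y" using that ab by (intro mult_left_mono) auto
    moreover have "0 < (\<alpha> + \<beta>) * 1 + (\<beta> - \<alpha>)" using ab(2) by simp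
    ultimately show ?thesis unfolding L_def by linarith
  qed
  have DL: "(L has_real_derivative \<alpha> + \<beta>) (at y)" for y
    unfolding L_def by (auto intro!: derivative_eq_intros)
  have DLp: "((\<lambda>y. L y powr q) has_real_derivative q * (\<alpha> + \<beta>) * L y powr (q - 1)) (at y)"
    if "1 \<le> y" for q y
    using DERIV_fun_powr[OF DL Lpos[OF that], of q] by (simp add: mult_ac)
  have DF: "(F has_real_derivative F1 y) (at y)" if "1 \<le> y" for y
    using DLp[OF that, of "- c"] by (simp add: F_def F1_def)
  have DF1: "(F1 has_real_derivative F2 y) (at y)" if "1 \<le> y" for y
  proof -
    have "(F1 has_real_derivative - c * (\<alpha> + \<beta>) * ((- c - 1) * (\<alpha> + \<beta>) * L y powr (- c - 1 - 1))) (at y)"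
      unfolding F1_def by (rule DERIV_cmult[OF DLp[OF that]])
    also have "- c * (\<alpha> + \<beta>) * ((- c - 1) * (\<alpha> + \<beta>) * L y powr (- c - 1 - 1)) = F2 y"
    proof -
      have "- c * a * ((- c - 1) * a * z) = c * (c + 1) * a\<^sup>2 * z" for a z
        by (simp add: algebra_simps power2_eq_square)
      moreover have "- c - 1 - 1 = - c - 2" by simp
      ultimately show ?thesis unfolding F2_def by metis
    qed
    finally show ?thesis .
  qed
  have F2c: "continuous_on {1..} F2"
    unfolding F2_def L_def
    by (intro continuous_intros) (use Lpos in \<open>force simp: L_def\<close>)
  have ode: "(y\<^sup>2 - 1) * F2 y + (2 * c + 2) * y * F1 y + c * (c + 1) * F y + F y powr (1 + 2 / c) = 0"
    if "1 \<le> y" for y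
  proof -
    define P a l where "P = L y powr (- c - 2)" and "a = \<alpha> + \<beta>" and "l = L y"
    note y = Lpos[OF that]
    have "- c * (1 + 2 / c) = - c - 2" using c by (simp add: distrib_left)
    then have Fp: "F y powr (1 + 2 / c) = P" by (simp add: F_def powr_powr P_def)
    have "L y powr ((- c - 2) + 1) = P * l" "L y powr ((- c - 2) + 2) = P * l\<^sup>2"
      using y unfolding powr_add by (simp_all add: P_def l_def)
    moreover have "(- c - 2) + 1 = - c - 1" "(- c - 2) + 2 = - c" by simp_all
    ultimately have pw: "L y powr (- c - 1) = P * l" "L y powr (- c) = P * l\<^sup>2"
      by (simp_all only:)
    have la: "l = a * y + (\<beta> - \<alpha>)" by (simp add: l_def L_def a_def)
    have "c * (c + 1) * (a\<^sup>2 - (\<beta> - \<alpha>)\<^sup>2) = c * (c + 1) * (4 * \<alpha> * \<beta>)"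
      by (simp add: a_def power2_eq_square algebra_simps)
    also have "\<dots> = 1" using c by (simp add: ab(3) add_pos_pos)
    finally have K: "c * (c + 1) * (a\<^sup>2 - (\<beta> - \<alpha>)\<^sup>2) = 1" .
    have "(y\<^sup>2 - 1) * F2 y + (2 * c + 2) * y * F1 y + c * (c + 1) * F y + F y powr (1 + 2 / c)
      = P * (c * (c + 1) * ((y\<^sup>2 - 1) * a\<^sup>2 - 2 * y * a * l + l\<^sup>2) + 1)"
      unfolding Fp unfolding F_def F1_def F2_def pw P_def[symmetric] a_def[symmetric]
      by (simp add: algebra_simps power2_eq_square)
    also have "(y\<^sup>2 - 1) * a\<^sup>2 - 2 * y * a * l + l\<^sup>2 = - (a\<^sup>2 - (\<beta> - \<alpha>)\<^sup>2)"
      unfolding la by (simp add: algebra_simps power2_eq_square)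
    also have "c * (c + 1) * - (a\<^sup>2 - (\<beta> - \<alpha>)\<^sup>2) + 1 = 0"
      using K unfolding mult_minus_right by linarith
    finally show ?thesis by simp
  qed
  have C2: "C2_on hyp_space (\<lambda>x :: real^'n. F (cosh_dist Q x))"
    by (rule C2_on_radial[OF Q DF DF1 F2c])
  have op: "open (hyp_space :: (real^'n) set)" by (simp add: hyp_space_def)
  have n: "2 \<le> CARD('n)" using N c by linarith
  have "hyp_laplacian (\<lambda>x. F (cosh_dist Q x)) x + c * (c + 1) * F (cosh_dist Q x)
      + F (cosh_dist Q x) powr (1 + 2 / c) = 0" if x: "x \<in> hyp_space" for x :: "real^'n"
  proof -
    note ge = cosh_dist_ge_1[OF _ Q]
    have "hyp_laplacian (\<lambda>x. F (cosh_dist Q x)) x = ((cosh_dist Q x)\<^sup>2 - 1) * F2 (cosh_dist Q x)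
        + real CARD('n) * cosh_dist Q x * F1 (cosh_dist Q x)"
      by (rule hyp_laplacian_radial[OF n op order_refl x Q, where F = F])
        (use DF DF1 ge x in auto)
    then show ?thesis using ode[OF ge[OF x]] by (simp add: N)
  qed
  then show ?thesis using C2 unfolding hyp_solution_on_def F_def L_def by blast
qed

theorem theorem1p3:
  fixes Q :: "real^'n::finite"
    and u :: "real^'n \<Rightarrow> real"
    and N :: nat
    and p lam :: real
  assumes N_def: "N = CARD('n)"
    and N_ge_3: "N \<ge> 3"
    and p_def: "p = (real N + 2) / (real N - 2)"
    and lam_def: "lam = real N * (real N - 2) / 4"
    and Q: "Q \<in> hyp_space"
    and solution: "hyp_solution_on lam p (hyp_space - {Q}) u"
    and positive: "\<forall>x\<in>hyp_space - {Q}. 0 < u x"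
    and radial: "radial_about Q u"
    and nonremovable: "\<not> removable_singularity lam p Q u"
  shows "(\<forall>x\<in>hyp_space - {Q}. u x = U_s N (hyp_dist x Q)) \<or>
    (\<exists>b T. 0 < b \<and> b < v_0 N \<and> 0 \<le> T \<and> T < T_per N b \<and>
       (\<forall>x\<in>hyp_space - {Q}.
          u x = sinh (hyp_dist x Q) powr (- ((real N - 2) / 2))
                * v_per N b (ln (tanh (hyp_dist x Q / 2)) + T)))"
proof -
  define c where "c = (real N - 2) / 2"
  have c: "0 < c" and N2: "2 < N" and n: "2 \<le> CARD('n)" using N_ge_3 N_def by (auto simp: c_def)
  have Nc: "real CARD('n) = 2 * c + 2" using N_def by (simp add: c_def field_simps)
  have pc: "p = 1 + 2 / c" using N_ge_3 unfolding p_def c_def by (simp add: field_simps)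
  have lc: "lam = c * (c + 1)" unfolding lam_def c_def by (simp add: field_simps)
  have op: "open (hyp_space - {Q})" by (simp add: hyp_space_def open_Diff)
  have C2: "C2_on (hyp_space - {Q}) u" using solution unfolding hyp_solution_on_def by blast
  have "\<exists>F F1 F2. (\<forall>x\<in>hyp_space - {Q}. u x = F (cosh_dist Q x)) \<and>
      (\<forall>y>1. (F has_real_derivative F1 y) (at y)) \<and> (\<forall>y>1. (F1 has_real_derivative F2 y) (at y)) \<and>
      (\<forall>y>1. \<exists>x\<in>hyp_space - {Q}. cosh_dist Q x = y)"
    by (rule radial_profile_exists[OF n Q C2 radial]) blast
  then obtain F F1 F2 where u: "\<And>x. x \<in> hyp_space - {Q} \<Longrightarrow> u x = F (cosh_dist Q x)"
    and F: "\<And>y. 1 < y \<Longrightarrow> (F has_real_derivative F1 y) (at y)"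
    and F1: "\<And>y. 1 < y \<Longrightarrow> (F1 has_real_derivative F2 y) (at y)"
    and onto: "\<And>y. 1 < y \<Longrightarrow> \<exists>x\<in>hyp_space - {Q}. cosh_dist Q x = y"
    by blast
  note gt = cosh_dist_gt_1[OF _ Q]
  have pos: "0 < F y" if "1 < y" for y
    using onto[OF that] u positive by metis
  have ode: "(y\<^sup>2 - 1) * F2 y + (2 * c + 2) * y * F1 y + c * (c + 1) * F y + F y powr (1 + 2 / c) = 0"
    if y: "1 < y" for y
  proof -
    obtain x where x: "x \<in> hyp_space - {Q}" "cosh_dist Q x = y" using onto[OF y] by blast
    have "hyp_laplacian u x = ((cosh_dist Q x)\<^sup>2 - 1) * F2 y
        + real CARD('n) * cosh_dist Q x * F1 (cosh_dist Q x)"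
      by (rule hyp_laplacian_radial[OF n op Diff_subset x(1) Q, where F = F])
        (use u F F1 gt x y in auto)
    moreover have "hyp_laplacian u x + lam * u x + u x powr p = 0"
      using solution x(1) unfolding hyp_solution_on_def by blast
    ultimately show ?thesis using u[OF x(1)] x(2) by (simp add: Nc pc lc)
  qed
  define V where "V = (\<lambda>s. sinh (- s) powr (- c) * F (cosh s / sinh (- s)))"
  obtain V' where V: "profile_on c {..<0} V V'"
    unfolding V_def by (rule cylinder_profile[OF c F F1 pos ode])
  let ?r = "\<lambda>x. hyp_dist x Q" and ?s = "\<lambda>x. ln (tanh (hyp_dist x Q / 2))"
  have r: "0 < ?r x" "cosh (?r x) = cosh_dist Q x" if "x \<in> hyp_space - {Q}" for x
    using gt[OF that] by (simp_all add: hyp_dist_eq)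
  have uF: "F (cosh (?r x)) = u x" if "x \<in> hyp_space - {Q}" for x
    using u[OF that] r(2)[OF that] by simp
  have s: "?s x < 0" "u x = sinh (?r x) powr (- c) * V (?s x)" if x: "x \<in> hyp_space - {Q}" for x
  proof -
    note cc = cylinder_coordinate[OF r(1)[OF x]]
    show "?s x < 0" by (rule cc(1))
    have S: "0 < sinh (?r x)" using r(1)[OF x] by simp
    have "V (?s x) = (1 / sinh (?r x)) powr (- c) * F (cosh (?r x))"
      unfolding V_def cc(2,3) using S by simp
    then show "u x = sinh (?r x) powr (- c) * V (?s x)"
      using S by (simp add: uF[OF x] powr_divide powr_minus)
  qed
  from c V show ?thesis
  proof (cases rule: profile_half_line_cases)
    case equilibrium
    have "u x = U_s N (?r x)" if x: "x \<in> hyp_space - {Q}" for x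
    proof -
      have "0 < sinh (?r x)" using r(1)[OF x] by simp
      then have "sinh (?r x) powr (- c) * c powr c = (c / sinh (?r x)) powr c"
        using c by (simp add: powr_divide powr_minus field_simps)
      then show ?thesis
        using s[OF x] equilibrium by (simp add: U_s_def c_def)
    qed
    then show ?thesis by blast
  next
    case (periodic W W' \<tau>)
    obtain b T where bT: "0 < b" "b < v_0 N" "0 \<le> T" "T < T_per N b"
      "\<And>t. W t = v_per N b (t + T)"
      using periodic_profile_is_v_per[OF N2 c_def periodic(1,3,2,4)] by metis
    have "u x = sinh (?r x) powr (- ((real N - 2) / 2)) * v_per N b (?s x + T)"
      if x: "x \<in> hyp_space - {Q}" for x
      using s[OF x] periodic(5) bT(5) by (simp add: c_def)
    then show ?thesis using bT(1-4) by blast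
  next
    case (homoclinic \<alpha> \<beta>)
    let ?w = "\<lambda>x. ((\<alpha> + \<beta>) * cosh_dist Q x + (\<beta> - \<alpha>)) powr (- c)"
    have "?w x = u x" if x: "x \<in> hyp_space - {Q}" for x
    proof -
      note cc = cylinder_coordinate[OF r(1)[OF x]]
      have S: "0 < sinh (?r x)" using r(1)[OF x] by simp
      have e: "exp (?s x) = (cosh (?r x) - 1) / sinh (?r x)"
        "exp (- ?s x) = (cosh (?r x) + 1) / sinh (?r x)"
        using cc(2,3) S by (simp_all flip: cosh_plus_sinh cosh_minus_sinh add: diff_divide_distrib add_divide_distrib)
      have "sinh (?r x) * (\<alpha> * exp (?s x) + \<beta> * exp (- ?s x))
          = \<alpha> * (cosh (?r x) - 1) + \<beta> * (cosh (?r x) + 1)"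
        unfolding e using S by (simp add: field_simps)
      also have "\<dots> = (\<alpha> + \<beta>) * cosh_dist Q x + (\<beta> - \<alpha>)"
        by (simp add: r(2)[OF x] algebra_simps)
      finally have "?w x = (sinh (?r x) * (\<alpha> * exp (?s x) + \<beta> * exp (- ?s x))) powr (- c)" by simp
      also have "\<dots> = sinh (?r x) powr (- c) * V (?s x)"
        using homoclinic(1,2) S s(1)[OF x] homoclinic(4) by (simp add: powr_mult)
      finally show ?thesis using s(2)[OF x] by simp
    qed
    then have "removable_singularity lam p Q u"
      unfolding removable_singularity_def
      using homoclinic_hyp_solution[OF Nc c Q homoclinic(1-3)] by (auto simp: lc pc)
    with nonremovable show ?thesis by blast
  qed
qed

end
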